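(* Suppose there exist constants $l_1,l_2>0$ such that for every $k=1,\dots,m$, $$\|U_k(x)\|\le l_1\quad\text{and}\quad \|U_k(x)-U_k(y)\|\le l_2\|x-y\|\qquad\text{for all }x,y\in\mathbb{R}^n.$$ If $$\frac{1+\|I-\rho A\|}{\Gamma(\alpha+1)}T^{\alpha}<1\quad\text{and}\quad m l_2+\frac{T^{\alpha}}{\Gamma(\alpha+1)}<1,$$ then the impulsive system $$\begin{cases}{}^{C}_{0}D^{\alpha}_t x(t)=-x(t)+P_K\big(x(t)-\rho A x(t)-\rho b\big), & t\in J',\\ x(t_k^+)-x(t_k^-)=U_k(x(t_k)), & k=1,\dots,m,\\ x(0)=x_0,\end{cases}$$ has at least one solution $x\in PC(J,\mathbb{R}^n)$.
   Context: Setting: $0<\alpha<1$, $T>0$, $J=[0,T]$, impulse times $0=t_0<t_1<\dots<t_m<t_{m+1}=T$, $J'=J\setminus\{t_1,\dots,t_m\}$; $A\in\mathbb{R}^{n\times n}$, $b\in\mathbb{R}^n$, $x_0\in\mathbb{R}^n$, $\rho$ a real constant, $I$ the identity matrix; $K\subset\mathbb{R}^n$ is nonempty, closed and convex, $P_K(y)=\arg\min_{z\in K}\|y-z\|$ is the Euclidean projection onto $K$; $U_k:\mathbb{R}^n\to\mathbb{R}^n$ ($k=1,\dots,m$) are the jump maps. $x(t_k^\pm)$ denote one-sided limits at $t_k$. $\|\cdot\|$ is the Euclidean norm for vectors and $\|A\|=\sqrt{\lambda_{\max}(A^TA)}$ for matrices. $PC(J,\mathbb{R}^n)$ is the space of functions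 $u:J\to\mathbb{R}^n$ that are continuous on $[0,t_1]$ and on each $(t_k,t_{k+1}]$, $k=1,\dots,m$, and for which $u(t_k^-)$ and $u(t_k^+)$ exist with $u(t_k^-)=u(t_k)$ for $k=1,\dots,m$. Caputo derivative of order $\alpha\in(0,1)$: ${}^{C}_{0}D^{\alpha}_t x(t)=\frac{1}{\Gamma(1-\alpha)}\int_0^t (t-s)^{-\alpha}x'(s)\,ds$, where $x'$ is the (a.e. defined) derivative. A function $x:J\to\mathbb{R}^n$ is a solution of the system on $J$ with $x(0)=x_0$ if (i) $x$ is absolutely continuous on $[0,t_1]$ and on each $(t_k,t_{k+1}]$, $k=1,\dots,m$; (ii) $x$ satisfies the system (the differential equation for almost all $t\in J$, together with the jump conditions and the initial condition); (iii) $x(t_k^-)$ and $x(t_k^+)$ exist with $x(t_k^-)=x(t_k)$ for $k=1,\dots,m$. *)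

theory Defs
  imports "HOL-Analysis.Analysis"
begin

definition spectral_norm :: "real^'n^'n \<Rightarrow> real" where
  "spectral_norm A =
     sqrt (Max {c. \<exists>v. v \<noteq> 0 \<and> (transpose A ** A) *v v = c *\<^sub>R v})"

(* Absolute continuity of a function; the library's absolutely_continuous is the
   unrelated notion for measures. A pair (a, b) encodes the interval from a to b. *)
definition abs_continuous_on :: "real set \<Rightarrow> (real \<Rightarrow> 'a::real_normed_vector) \<Rightarrow> bool" where
  "abs_continuous_on S f \<longleftrightarrow>
     (\<forall>\<epsilon>>0. \<exists>\<delta>>0. \<forall>D::(real \<times> real) set.
        finite D \<and>
        (\<forall>(a, b)\<in>D. a < b \<and> {a..b} \<subseteq> S) \<and>
        (\<forall>p\<in>D. \<forall>q\<in>D. p \<noteq> q \<longrightarrow> {fst p<..<snd p} \<inter> {fst q<..<snd q} = {}) \<and>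
        (\<Sum>(a, b)\<in>D. b - a) < \<delta>
        \<longrightarrow> (\<Sum>(a, b)\<in>D. norm (f b - f a)) < \<epsilon>)"

(* t 0, ..., t (m+1) are the impulse times together with the end points of [0,T];
   the values t k for k > m+1 play no role. *)
definition impulse_times :: "nat \<Rightarrow> real \<Rightarrow> (nat \<Rightarrow> real) \<Rightarrow> bool" where
  "impulse_times m T t \<longleftrightarrow>
     t 0 = 0 \<and> t (Suc m) = T \<and> (\<forall>k\<le>m. t k < t (Suc k))"

(* Functions on [0,T] are represented by total functions on the reals;
   values outside [0,T] are irrelevant. *)
definition one_sided_limits :: "nat \<Rightarrow> (nat \<Rightarrow> real) \<Rightarrow> (real \<Rightarrow> 'a::real_normed_vector) \<Rightarrow> bool" where
  "one_sided_limits m t u \<longleftrightarrow>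
     (\<forall>k\<in>{1..m}. (u \<longlongrightarrow> u (t k)) (at_left (t k)) \<and> (\<exists>l. (u \<longlongrightarrow> l) (at_right (t k))))"

definition PC :: "nat \<Rightarrow> (nat \<Rightarrow> real) \<Rightarrow> (real \<Rightarrow> 'a::real_normed_vector) set" where
  "PC m t = {u. continuous_on {0..t 1} u \<and>
                (\<forall>k\<in>{1..m}. continuous_on {t k<..t (Suc k)} u) \<and>
                one_sided_limits m t u}"

(* The Caputo derivative of order \<alpha> of x at t, with lower limit 0, exists and equals v.
   Differentiability almost everywhere and integrability are part of the notion, so that the
   default values of vector_derivative and of the Lebesgue integral are never used. *)
definition has_caputo_derivative ::
    "real \<Rightarrow> (real \<Rightarrow> 'a::euclidean_space) \<Rightarrow> 'a \<Rightarrow> real \<Rightarrow> bool" where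
  "has_caputo_derivative \<alpha> x v t \<longleftrightarrow>
     (AE s in lebesgue. s \<in> {0..t} \<longrightarrow> x differentiable (at s)) \<and>
     set_integrable lebesgue {0..t} (\<lambda>s. (t - s) powr (-\<alpha>) *\<^sub>R vector_derivative x (at s)) \<and>
     v = (1 / Gamma (1 - \<alpha>)) *\<^sub>R
           (LINT s:{0..t}|lebesgue. (t - s) powr (-\<alpha>) *\<^sub>R vector_derivative x (at s))"

(* The library's closest_point K is the projection P_K. *)
definition is_solution ::
    "real \<Rightarrow> real \<Rightarrow> nat \<Rightarrow> (nat \<Rightarrow> real) \<Rightarrow> real^'n^'n \<Rightarrow> real^'n \<Rightarrow> real \<Rightarrow> (real^'n) set \<Rightarrow>
     (nat \<Rightarrow> real^'n \<Rightarrow> real^'n) \<Rightarrow> real^'n \<Rightarrow> (real \<Rightarrow> real^'n) \<Rightarrow> bool" where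
  "is_solution \<alpha> T m t A b \<rho> K U x0 x \<longleftrightarrow>
     abs_continuous_on {0..t 1} x \<and>
     (\<forall>k\<in>{1..m}. abs_continuous_on {t k<..t (Suc k)} x) \<and>
     (AE s in lebesgue. s \<in> {0..T} - t ` {1..m} \<longrightarrow>
        has_caputo_derivative \<alpha> x
          (- x s + closest_point K (x s - \<rho> *\<^sub>R (A *v x s) - \<rho> *\<^sub>R b)) s) \<and>
     (\<forall>k\<in>{1..m}. Lim (at_right (t k)) x - Lim (at_left (t k)) x = U k (x (t k))) \<and>
     x 0 = x0 \<and>
     one_sided_limits m t x"

end

theory Submission
  imports Defs
begin

text \<open>
  Integrating the Caputo equation turns the impulsive system into a Volterra equation
  \[ x(s) = x_0 + \sum_{t_k < s} U_k(x(t_k)) + (J^\alpha g)(s), \qquad g = 1_{(0,T]}\, (f \circ x), \]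
  where \<open>f\<close> is the projected field and \<open>J\<^sup>\<alpha>\<close> is the Riemann--Liouville integral of order \<open>\<alpha>\<close>.
  The right-hand side is a contraction for the norm \<open>sup |x(s)| exp (- \<theta> s)\<close>: the jumps contribute
  at most \<open>m l2 < 1\<close>, because the weight decreases after a jump, and the Laplace transform of the
  kernel bounds the contribution of \<open>J\<^sup>\<alpha>\<close> by \<open>L \<theta>\<^sup>-\<^sup>\<alpha>\<close>, where \<open>L\<close> is a Lipschitz constant of \<open>f\<close>; this
  is as small as desired once \<open>\<theta>\<close> is large (\<open>picard_contraction\<close>, \<open>solution_fixed_point\<close>).

  The difficulty is that a fixed point must be absolutely continuous between impulses, whereas
  \<open>J\<^sup>\<alpha> g\<close> is in general only Hoelder continuous for a continuous \<open>g\<close>.  The equation feeds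
  regularity back into itself: if the increments of \<open>x\<close> are dominated by \<open>\<integral> W\<close> away from the
  impulse times, then those of \<open>f \<circ> x\<close> are dominated by \<open>\<integral> L W\<close> plus an atom of bounded mass at
  each \<open>t\<^sub>k\<close>, and since \<open>J\<^sup>\<alpha>\<close> is a convolution with a positive kernel, those of \<open>J\<^sup>\<alpha> g\<close> are
  dominated by the integral of \<open>J\<^sup>\<alpha>\<close> of that measure (\<open>rl_integral_variation\<close>).  Along the Picard
  iterates this yields an increasing sequence of majorants whose integrals with weight
  \<open>exp (- \<theta> u)\<close> stay bounded, so their supremum is integrable up to time \<open>T\<close> and dominates the
  increments of the limit (\<open>varies_by_solution\<close>, \<open>majorant_finite\<close>).

  It remains to verify the equation.  By Radon--Nikodym, \<open>J\<^sup>\<alpha> g = J\<^sup>1 z\<close> with an integrable \<open>z\<close>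
  (\<open>rl_integral_density\<close>), and by Lebesgue's differentiation theorem \<open>z\<close> is the derivative of \<open>x\<close>
  almost everywhere.  The semigroup law of fractional integrals gives
  \<open>J\<^sup>1 J\<^sup>1\<^sup>-\<^sup>\<alpha> z = J\<^sup>1\<^sup>-\<^sup>\<alpha> J\<^sup>1 z = J\<^sup>1\<^sup>-\<^sup>\<alpha> J\<^sup>\<alpha> g = J\<^sup>1 g\<close>, and differentiating once more, \<open>J\<^sup>1\<^sup>-\<^sup>\<alpha> z = g\<close> almost
  everywhere, which is the Caputo equation (\<open>rl_integral_inversion\<close>, \<open>solution_caputo\<close>).
\<close>

section \<open>Riemann--Liouville kernels and integrals\<close>

text \<open>The kernel vanishes at and below \<open>0\<close>, so that fractional integrals are convolutions over the
  whole line; all domains of integration are then handled by the kernel.\<close>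

definition rl_kernel :: "real \<Rightarrow> real \<Rightarrow> real" where
  "rl_kernel a r = indicator {0<..} r * r powr (a - 1) / Gamma a"

definition rl_integral :: "real \<Rightarrow> (real \<Rightarrow> 'a::euclidean_space) \<Rightarrow> real \<Rightarrow> 'a" where
  "rl_integral a \<phi> t = (\<integral>s. rl_kernel a (t - s) *\<^sub>R \<phi> s \<partial>lborel)"

lemma rl_kernel_measurable [measurable]: "rl_kernel a \<in> borel_measurable borel"
  unfolding rl_kernel_def[abs_def] by measurable

lemma rl_kernel_nonneg: "0 < a \<Longrightarrow> 0 \<le> rl_kernel a r"
  by (auto simp: rl_kernel_def intro!: divide_nonneg_pos mult_nonneg_nonneg)

lemma rl_kernel_one: "rl_kernel 1 r = indicator {0<..} r"
  by (auto simp: rl_kernel_def indicator_def)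

lemma nn_integral_shift_lborel:
  fixes c :: real
  assumes [measurable]: "f \<in> borel_measurable borel"
  shows "(\<integral>\<^sup>+r. f (r + c) \<partial>lborel) = (\<integral>\<^sup>+r. f r \<partial>lborel)"
  using nn_integral_real_affine[of f 1 c] by (simp add: add.commute)

lemma nn_integral_reflect_lborel:
  fixes c :: real
  assumes [measurable]: "f \<in> borel_measurable borel"
  shows "(\<integral>\<^sup>+r. f (c - r) \<partial>lborel) = (\<integral>\<^sup>+r. f r \<partial>lborel)"
  using nn_integral_real_affine[of f "-1" c] by simp

text \<open>The substitution \<open>r \<mapsto> \<theta> r\<close> in Euler's integral for \<open>Gamma a\<close>.\<close>

lemma rl_kernel_laplace:
  assumes a: "0 < a" and l: "0 < \<theta>"
  shows "(\<integral>\<^sup>+r. ennreal (rl_kernel a r * exp (- \<theta> * r)) \<partial>lborel) = ennreal (\<theta> powr - a)"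
proof -
  have "ennreal (Gamma a)
      = (\<integral>\<^sup>+r. ennreal (indicator {0..} r * r powr (a - 1) / exp r) \<partial>lborel)"
    using a by (rule Gamma_conv_nn_integral_real)
  also have "\<dots> = \<theta> * (\<integral>\<^sup>+r. ennreal (indicator {0..} (\<theta> * r) * (\<theta> * r) powr (a - 1) / exp (\<theta> * r)) \<partial>lborel)"
    using l by (subst nn_integral_real_affine[where c=\<theta> and t=0]) auto
  also have "\<dots> = (\<integral>\<^sup>+r. ennreal \<theta> * ennreal (indicator {0..} (\<theta> * r) * (\<theta> * r) powr (a - 1) / exp (\<theta> * r)) \<partial>lborel)"
    by (rule nn_integral_cmult[symmetric]) simp
  also have "\<dots> = (\<integral>\<^sup>+r. ennreal (Gamma a * \<theta> powr a) * ennreal (rl_kernel a r * exp (- \<theta> * r)) \<partial>lborel)"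
  proof (rule nn_integral_cong)
    fix r :: real
    have "\<theta> * (indicator {0..} (\<theta> * r) * (\<theta> * r) powr (a - 1) / exp (\<theta> * r))
        = Gamma a * \<theta> powr a * (rl_kernel a r * exp (- \<theta> * r))"
    proof (cases "r > 0")
      case True
      have "\<theta> powr a = \<theta> * \<theta> powr (a - 1)"
        using l by (simp add: powr_diff)
      moreover have "Gamma a \<noteq> 0" using a by (simp add: Gamma_real_pos less_imp_neq[symmetric])
      moreover have "0 \<le> \<theta> * r" using l True by simp
      ultimately show ?thesis
        using True l by (simp add: rl_kernel_def powr_mult exp_minus field_simps)
    next
      case False
      then show ?thesis using l by (cases "r = 0") (auto simp: rl_kernel_def indicator_def zero_le_mult_iff)
    qed
    then show "ennreal \<theta> * ennreal (indicator {0..} (\<theta> * r) * (\<theta> * r) powr (a - 1) / exp (\<theta> * r))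
       = ennreal (Gamma a * \<theta> powr a) * ennreal (rl_kernel a r * exp (- \<theta> * r))"
      using l a by (simp add: ennreal_mult'[symmetric])
  qed
  also have "\<dots> = ennreal (Gamma a * \<theta> powr a) * (\<integral>\<^sup>+r. ennreal (rl_kernel a r * exp (- \<theta> * r)) \<partial>lborel)"
    by (rule nn_integral_cmult) simp
  finally have *: "ennreal (Gamma a) = ennreal (Gamma a * \<theta> powr a) *
     (\<integral>\<^sup>+r. ennreal (rl_kernel a r * exp (- \<theta> * r)) \<partial>lborel)" (is "_ = _ * ?I") .
  have pos: "0 < Gamma a * \<theta> powr a" using a l by simp
  have "?I = ?I * ennreal (Gamma a * \<theta> powr a) / ennreal (Gamma a * \<theta> powr a)"
    by (rule mult_divide_eq_ennreal[symmetric]) (use pos in \<open>auto simp only: ennreal_eq_0_iff ennreal_neq_top\<close>)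
  also have "\<dots> = ennreal (Gamma a) / ennreal (Gamma a * \<theta> powr a)"
    by (subst *) (simp only: mult.commute)
  also have "\<dots> = ennreal (\<theta> powr - a)"
    using a l by (subst divide_ennreal) (auto simp: powr_minus field_simps less_imp_neq[symmetric] Gamma_real_pos)
  finally show ?thesis .
qed

text \<open>Fractional integration multiplies an exponential by \<open>\<theta> powr - a\<close>.  This is what makes the
  weighted norm contract.\<close>

lemma rl_kernel_laplace_past:
  assumes a: "0 < a" and l: "0 < \<theta>"
  shows "(\<integral>\<^sup>+r. ennreal (rl_kernel a (s - r) * exp (\<theta> * r)) \<partial>lborel) = ennreal (\<theta> powr - a * exp (\<theta> * s))"
proof -
  have "(\<integral>\<^sup>+r. ennreal (rl_kernel a (s - r) * exp (\<theta> * r)) \<partial>lborel)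
      = (\<integral>\<^sup>+r. ennreal (rl_kernel a r * exp (\<theta> * (s - r))) \<partial>lborel)"
    using nn_integral_reflect_lborel[of "\<lambda>r. ennreal (rl_kernel a r * exp (\<theta> * (s - r)))" s] by simp
  also have "\<dots> = (\<integral>\<^sup>+r. ennreal (exp (\<theta> * s)) * ennreal (rl_kernel a r * exp (- \<theta> * r)) \<partial>lborel)"
    by (intro nn_integral_cong) (simp add: ennreal_mult'[symmetric] exp_diff exp_minus field_simps)
  also have "\<dots> = ennreal (\<theta> powr - a * exp (\<theta> * s))"
    by (subst nn_integral_cmult, measurable, subst rl_kernel_laplace[OF a l])
       (simp add: ennreal_mult'[symmetric] mult.commute)
  finally show ?thesis .
qed

text \<open>The dual form, for transporting the weight \<open>exp (- \<theta> u)\<close> through a convolution.\<close>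

lemma rl_kernel_laplace_future:
  assumes a: "0 < a" and l: "0 < \<theta>"
  shows "(\<integral>\<^sup>+u. ennreal (exp (- \<theta> * u) * rl_kernel a (u - r)) \<partial>lborel) = ennreal (\<theta> powr - a * exp (- \<theta> * r))"
proof -
  have "(\<integral>\<^sup>+u. ennreal (exp (- \<theta> * u) * rl_kernel a (u - r)) \<partial>lborel)
      = (\<integral>\<^sup>+u. ennreal (exp (- \<theta> * (u + r)) * rl_kernel a u) \<partial>lborel)"
    using nn_integral_shift_lborel[of "\<lambda>u. ennreal (exp (- \<theta> * u) * rl_kernel a (u - r))" r] by simp
  also have "\<dots> = (\<integral>\<^sup>+u. ennreal (exp (- \<theta> * r)) * ennreal (rl_kernel a u * exp (- \<theta> * u)) \<partial>lborel)"
    by (intro nn_integral_cong) (simp add: ennreal_mult'[symmetric] exp_diff exp_minus exp_add field_simps)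
  also have "\<dots> = ennreal (\<theta> powr - a * exp (- \<theta> * r))"
    by (subst nn_integral_cmult, measurable, subst rl_kernel_laplace[OF a l])
       (simp add: ennreal_mult'[symmetric] mult.commute)
  finally show ?thesis .
qed

text \<open>Rescaling \<open>[s, \<tau>]\<close> to the unit interval produces Euler's Beta integral, whose value is a
  quotient of Gamma values.\<close>

lemma rl_kernel_convolution:
  assumes a: "0 < a" and b: "0 < b"
  shows "(\<integral>\<^sup>+v. ennreal (rl_kernel a (\<tau> - v) * rl_kernel b (v - s)) \<partial>lborel) = ennreal (rl_kernel (a + b) (\<tau> - s))"
proof (cases "s < \<tau>")
  case False
  have "rl_kernel a (\<tau> - v) * rl_kernel b (v - s) = 0" for v
    using False by (auto simp: rl_kernel_def indicator_def)
  moreover have "rl_kernel (a + b) (\<tau> - s) = 0" using False by (simp add: rl_kernel_def)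
  ultimately show ?thesis by (simp only: ennreal_0 nn_integral_const mult_zero_left)
next
  case True
  define d where "d = \<tau> - s"
  have d: "0 < d" using True by (simp add: d_def)
  define c where "c = d powr (a + b - 1) / (Gamma a * Gamma b)"
  have Gpos: "0 < Gamma a" "0 < Gamma b" "0 < Gamma (a + b)" using a b by (auto simp: Gamma_real_pos)
  have c: "0 \<le> c" using d Gpos by (simp add: c_def)
  have "(\<integral>\<^sup>+v. ennreal (rl_kernel a (\<tau> - v) * rl_kernel b (v - s)) \<partial>lborel)
      = ennreal d * (\<integral>\<^sup>+u. ennreal (rl_kernel a (d * (1 - u)) * rl_kernel b (d * u)) \<partial>lborel)"
    using d by (subst nn_integral_real_affine[where c=d and t=s]) (auto simp: d_def algebra_simps)
  also have "\<dots> = (\<integral>\<^sup>+u. ennreal d * ennreal (rl_kernel a (d * (1 - u)) * rl_kernel b (d * u)) \<partial>lborel)"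
    by (rule nn_integral_cmult[symmetric]) simp
  also have "\<dots> = (\<integral>\<^sup>+u. ennreal c * ennreal (indicator {0..1} u * (u powr (b - 1) * (1 - u) powr (a - 1))) \<partial>lborel)"
  proof (rule nn_integral_cong)
    fix u :: real
    have "d * (rl_kernel a (d * (1 - u)) * rl_kernel b (d * u))
        = c * (indicator {0..1} u * (u powr (b - 1) * (1 - u) powr (a - 1)))"
    proof (cases "0 < u \<and> u < 1")
      case True
      have "d powr (a + b - 1) = d * d powr (a - 1) * d powr (b - 1)"
        using d by (simp add: powr_add powr_diff field_simps)
      then show ?thesis
        using True d by (simp add: rl_kernel_def c_def powr_mult)
    next
      case False
      then show ?thesis
        using d by (auto simp: rl_kernel_def indicator_def zero_less_mult_iff not_less)
    qed
    then show "ennreal d * ennreal (rl_kernel a (d * (1 - u)) * rl_kernel b (d * u))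
      = ennreal c * ennreal (indicator {0..1} u * (u powr (b - 1) * (1 - u) powr (a - 1)))"
      using d c by (simp add: ennreal_mult'[symmetric])
  qed
  also have "\<dots> = ennreal c * ennreal (Beta b a)"
    using nn_integral_has_integral_lebesgue[OF _ has_integral_Beta_real[OF b a]]
    by (subst nn_integral_cmult) (auto simp: mult.assoc)
  also have "\<dots> = ennreal (rl_kernel (a + b) (\<tau> - s))"
    using Gpos c d
    by (simp add: ennreal_mult'[symmetric] Beta_def c_def rl_kernel_def d_def[symmetric] add.commute mult.commute)
  finally show ?thesis .
qed

text \<open>Fubini's theorem together with the convolution law of the kernels.  Integrability is required
  only of the composed integral: as the kernels are nonnegative, it gives integrability of the
  double integral, and hence of almost all inner integrals.\<close>

lemma rl_integral_semigroup:
  fixes \<phi> :: "real \<Rightarrow> 'a::euclidean_space"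
  assumes a: "0 < a" and b: "0 < b"
    and [measurable]: "\<phi> \<in> borel_measurable borel"
    and int: "integrable lborel (\<lambda>s. rl_kernel (a + b) (\<tau> - s) *\<^sub>R \<phi> s)"
  shows "AE v in lborel. v < \<tau> \<longrightarrow> integrable lborel (\<lambda>s. rl_kernel b (v - s) *\<^sub>R \<phi> s)"
    and "integrable lborel (\<lambda>v. rl_kernel a (\<tau> - v) *\<^sub>R rl_integral b \<phi> v)"
    and "rl_integral a (rl_integral b \<phi>) \<tau> = rl_integral (a + b) \<phi> \<tau>"
proof -
  define f where "f v s = (rl_kernel a (\<tau> - v) * rl_kernel b (v - s)) *\<^sub>R \<phi> s" for v s
  have [measurable]: "case_prod f \<in> borel_measurable (lborel \<Otimes>\<^sub>M lborel)"
    unfolding f_def[abs_def] by measurable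
  have nf: "ennreal (norm (f v s)) = ennreal (norm (\<phi> s)) * ennreal (rl_kernel a (\<tau> - v) * rl_kernel b (v - s))" for v s
    using a b by (simp add: f_def ennreal_mult'[symmetric] rl_kernel_nonneg mult.commute)
  have "(\<integral>\<^sup>+p. ennreal (norm (case_prod f p)) \<partial>(lborel \<Otimes>\<^sub>M lborel))
      = (\<integral>\<^sup>+s. \<integral>\<^sup>+v. ennreal (norm (f v s)) \<partial>lborel \<partial>lborel)"
    by (subst lborel.nn_integral_fst[symmetric], simp, subst lborel_pair.Fubini') simp_all
  also have "\<dots> = (\<integral>\<^sup>+s. ennreal (norm (rl_kernel (a + b) (\<tau> - s) *\<^sub>R \<phi> s)) \<partial>lborel)"
    unfolding nf using a b
    by (intro nn_integral_cong, subst nn_integral_cmult)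
       (auto simp: rl_kernel_convolution[OF a b] ennreal_mult'[symmetric] rl_kernel_nonneg mult.commute)
  also have "\<dots> < \<infinity>"
    using int by (simp add: integrable_iff_bounded)
  finally have fint: "integrable (lborel \<Otimes>\<^sub>M lborel) (case_prod f)"
    by (intro integrableI_bounded) auto
  have f1: "(\<integral>s. f v s \<partial>lborel) = rl_kernel a (\<tau> - v) *\<^sub>R rl_integral b \<phi> v" for v
    by (simp add: f_def rl_integral_def flip: scaleR_scaleR)
  have f2: "(\<integral>v. f v s \<partial>lborel) = rl_kernel (a + b) (\<tau> - s) *\<^sub>R \<phi> s" for s
  proof -
    have nn: "0 \<le> rl_kernel a (\<tau> - v) * rl_kernel b (v - s)" for v
      using a b by (simp add: rl_kernel_nonneg)
    have i: "has_bochner_integral lborel (\<lambda>v. rl_kernel a (\<tau> - v) * rl_kernel b (v - s)) (rl_kernel (a + b) (\<tau> - s))"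
      using a b nn by (intro has_bochner_integral_nn_integral)
        (auto simp: rl_kernel_convolution rl_kernel_nonneg)
    have "has_bochner_integral lborel (\<lambda>v. f v s) (rl_kernel (a + b) (\<tau> - s) *\<^sub>R \<phi> s)"
      unfolding f_def by (rule has_bochner_integral_scaleR_left) (rule i)
    then show ?thesis by (rule has_bochner_integral_integral_eq)
  qed
  show "AE v in lborel. v < \<tau> \<longrightarrow> integrable lborel (\<lambda>s. rl_kernel b (v - s) *\<^sub>R \<phi> s)"
    using lborel_pair.AE_integrable_fst[OF fint]
  proof eventually_elim
    case (elim v)
    show ?case
    proof
      assume "v < \<tau>"
      then have "rl_kernel a (\<tau> - v) \<noteq> 0" using a by (simp add: rl_kernel_def Gamma_real_pos less_imp_neq[symmetric])
      then show "integrable lborel (\<lambda>s. rl_kernel b (v - s) *\<^sub>R \<phi> s)"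
        using integrable_scaleR_right[of "inverse (rl_kernel a (\<tau> - v))" lborel "f v"] elim
        by (simp add: f_def mult.assoc[symmetric])
    qed
  qed
  show "integrable lborel (\<lambda>v. rl_kernel a (\<tau> - v) *\<^sub>R rl_integral b \<phi> v)"
    using lborel_pair.integrable_fst[OF fint] by (simp add: f1)
  show "rl_integral a (rl_integral b \<phi>) \<tau> = rl_integral (a + b) \<phi> \<tau>"
    using lborel_pair.Fubini_integral[OF fint] unfolding f1 f2 by (simp add: rl_integral_def)
qed

text \<open>Domination of \<open>\<phi>\<close> by an exponential is reproduced with the factor \<open>\<theta> powr - a\<close>.\<close>

lemma rl_integral_exp_bound:
  fixes \<phi> :: "real \<Rightarrow> 'a::euclidean_space"
  assumes a: "0 < a" and \<theta>: "0 < \<theta>" and [measurable]: "\<phi> \<in> borel_measurable borel"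
    and bound: "\<And>r. norm (\<phi> r) \<le> C * exp (\<theta> * r)"
  shows "integrable lborel (\<lambda>r. rl_kernel a (s - r) *\<^sub>R \<phi> r)"
    and "norm (rl_integral a \<phi> s) \<le> C * \<theta> powr - a * exp (\<theta> * s)"
proof -
  have C: "0 \<le> C"
    using order_trans[OF norm_ge_zero bound, of 0] by simp
  have "(\<integral>\<^sup>+r. ennreal (norm (rl_kernel a (s - r) *\<^sub>R \<phi> r)) \<partial>lborel)
      \<le> (\<integral>\<^sup>+r. ennreal C * ennreal (rl_kernel a (s - r) * exp (\<theta> * r)) \<partial>lborel)"
  proof (intro nn_integral_mono)
    fix r
    have "norm (rl_kernel a (s - r) *\<^sub>R \<phi> r) \<le> rl_kernel a (s - r) * (C * exp (\<theta> * r))"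
      using bound[of r] a by (simp add: rl_kernel_nonneg mult_left_mono)
    then show "ennreal (norm (rl_kernel a (s - r) *\<^sub>R \<phi> r)) \<le> ennreal C * ennreal (rl_kernel a (s - r) * exp (\<theta> * r))"
      using C by (simp add: ennreal_mult'[symmetric] ennreal_leI mult_ac)
  qed
  also have "\<dots> = ennreal (C * \<theta> powr - a * exp (\<theta> * s))"
    using C by (subst nn_integral_cmult) (simp_all add: rl_kernel_laplace_past[OF a \<theta>] ennreal_mult'[symmetric] mult.assoc)
  finally have le: "(\<integral>\<^sup>+r. ennreal (norm (rl_kernel a (s - r) *\<^sub>R \<phi> r)) \<partial>lborel) \<le> ennreal (C * \<theta> powr - a * exp (\<theta> * s))" .
  show i: "integrable lborel (\<lambda>r. rl_kernel a (s - r) *\<^sub>R \<phi> r)"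
    using le by (intro integrableI_bounded) (auto intro: le_less_trans)
  have "ennreal (norm (rl_integral a \<phi> s)) \<le> ennreal (C * \<theta> powr - a * exp (\<theta> * s))"
    unfolding rl_integral_def using integral_norm_bound_ennreal[OF i] le by (rule order_trans)
  then show "norm (rl_integral a \<phi> s) \<le> C * \<theta> powr - a * exp (\<theta> * s)"
    using C by (subst (asm) ennreal_le_iff) auto
qed

lemma rl_integral_measurable [measurable]:
  fixes \<phi> :: "real \<Rightarrow> 'a::euclidean_space"
  assumes [measurable]: "\<phi> \<in> borel_measurable borel"
  shows "rl_integral a \<phi> \<in> borel_measurable borel"
  unfolding rl_integral_def[abs_def] by measurable

text \<open>With respect to the weight \<open>exp (- \<theta> u)\<close>, fractional integration scales the total mass by
  \<open>\<theta> powr - a\<close>; the proof exchanges the integrals.\<close>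

lemma rl_kernel_weighted:
  fixes W :: "real \<Rightarrow> ennreal"
  assumes a: "0 < a" and \<theta>: "0 < \<theta>" and [measurable]: "W \<in> borel_measurable borel"
  shows "(\<integral>\<^sup>+u. ennreal (exp (- \<theta> * u)) * (\<integral>\<^sup>+r. ennreal (rl_kernel a (u - r)) * W r \<partial>lborel) \<partial>lborel)
    = ennreal (\<theta> powr - a) * (\<integral>\<^sup>+r. ennreal (exp (- \<theta> * r)) * W r \<partial>lborel)"
proof -
  have "(\<integral>\<^sup>+u. ennreal (exp (- \<theta> * u)) * (\<integral>\<^sup>+r. ennreal (rl_kernel a (u - r)) * W r \<partial>lborel) \<partial>lborel)
     = (\<integral>\<^sup>+u. \<integral>\<^sup>+r. ennreal (exp (- \<theta> * u) * rl_kernel a (u - r)) * W r \<partial>lborel \<partial>lborel)"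
    by (simp add: nn_integral_cmult[symmetric] ennreal_mult' mult.assoc)
  also have "\<dots> = (\<integral>\<^sup>+r. \<integral>\<^sup>+u. ennreal (exp (- \<theta> * u) * rl_kernel a (u - r)) * W r \<partial>lborel \<partial>lborel)"
    by (rule lborel_pair.Fubini') simp
  also have "\<dots> = (\<integral>\<^sup>+r. ennreal (\<theta> powr - a) * (ennreal (exp (- \<theta> * r)) * W r) \<partial>lborel)"
    by (intro nn_integral_cong, subst nn_integral_multc)
       (simp, simp only: rl_kernel_laplace_future[OF a \<theta>] ennreal_mult' powr_ge_zero mult.assoc)
  also have "\<dots> = ennreal (\<theta> powr - a) * (\<integral>\<^sup>+r. ennreal (exp (- \<theta> * r)) * W r \<partial>lborel)"
    by (rule nn_integral_cmult) simp
  finally show ?thesis .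
qed

section \<open>Variation of a fractional integral\<close>

lemma rl_integral_shift:
  fixes g :: "real \<Rightarrow> 'a::euclidean_space"
  shows "rl_integral a g (s + h) = (\<integral>r. rl_kernel a (s - r) *\<^sub>R g (r + h) \<partial>lborel)"
  unfolding rl_integral_def
  by (subst lborel_integral_real_affine[where c=1 and t=h]) (simp_all add: algebra_simps)

text \<open>The contribution of a unit atom at \<open>p\<close>: the translates of the window that contain \<open>p\<close> sweep
  out the kernel issued from \<open>p\<close> over the interval from \<open>s\<close> to \<open>t\<close>.\<close>

lemma rl_kernel_window:
  assumes a: "0 < a" and st: "s < t"
  shows "(\<integral>\<^sup>+r. ennreal (rl_kernel a (s - r)) * indicator {r..<r + (t - s)} p \<partial>lborel)
       = (\<integral>\<^sup>+u\<in>{s<..t}. ennreal (rl_kernel a (u - p)) \<partial>lborel)"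
proof -
  let ?f = "\<lambda>r. ennreal (rl_kernel a (s - r)) * indicator {r..<r + (t - s)} p"
  have f: "?f = (\<lambda>r. ennreal (rl_kernel a (s - r)) * indicator {p - (t - s)<..p} r)"
    by (auto simp: indicator_def fun_eq_iff)
  have "(\<integral>\<^sup>+r. ?f r \<partial>lborel) = (\<integral>\<^sup>+u. ?f (p + s - u) \<partial>lborel)"
    by (rule nn_integral_reflect_lborel[symmetric]) (simp add: f)
  also have "\<dots> = (\<integral>\<^sup>+u\<in>{s<..t}. ennreal (rl_kernel a (u - p)) \<partial>lborel)"
    using AE_lborel_singleton[of s] AE_lborel_singleton[of t]
    by (intro nn_integral_cong_AE, eventually_elim) (auto simp: indicator_def algebra_simps)
  finally show ?thesis .
qed

text \<open>The same computation for a density \<open>W\<close> in place of an atom, by Tonelli and translation.\<close>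

lemma rl_kernel_accumulate:
  fixes W :: "real \<Rightarrow> ennreal"
  assumes a: "0 < a" and st: "s < t" and [measurable]: "W \<in> borel_measurable borel"
  shows "(\<integral>\<^sup>+r. ennreal (rl_kernel a (s - r)) * (\<integral>\<^sup>+u\<in>{r<..r + (t - s)}. W u \<partial>lborel) \<partial>lborel)
       = (\<integral>\<^sup>+u\<in>{s<..t}. (\<integral>\<^sup>+r. ennreal (rl_kernel a (u - r)) * W r \<partial>lborel) \<partial>lborel)"
proof -
  let ?k = "\<lambda>x. ennreal (rl_kernel a x)"
  let ?i = "indicator {0<..t - s} :: real \<Rightarrow> ennreal"
  have "(\<integral>\<^sup>+u\<in>{r<..r + (t - s)}. W u \<partial>lborel) = (\<integral>\<^sup>+v. W (v + r) * ?i v \<partial>lborel)" for r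
    by (subst nn_integral_shift_lborel[of _ r, symmetric])
       (auto intro!: nn_integral_cong simp: indicator_def)
  then have "(\<integral>\<^sup>+r. ?k (s - r) * (\<integral>\<^sup>+u\<in>{r<..r + (t - s)}. W u \<partial>lborel) \<partial>lborel)
      = (\<integral>\<^sup>+r. \<integral>\<^sup>+v. ?k (s - r) * (W (v + r) * ?i v) \<partial>lborel \<partial>lborel)"
    by (simp add: nn_integral_cmult)
  also have "\<dots> = (\<integral>\<^sup>+v. \<integral>\<^sup>+r. ?k (s - r) * (W (v + r) * ?i v) \<partial>lborel \<partial>lborel)"
    by (rule lborel_pair.Fubini') simp
  also have "\<dots> = (\<integral>\<^sup>+v. (\<integral>\<^sup>+r. ?k (s + v - r) * W r \<partial>lborel) * ?i v \<partial>lborel)"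
  proof (rule nn_integral_cong)
    fix v :: real
    have "(\<integral>\<^sup>+r. ?k (s - r) * (W (v + r) * ?i v) \<partial>lborel) = (\<integral>\<^sup>+r. ?k (s + v - (r + v)) * W (r + v) \<partial>lborel) * ?i v"
      by (subst nn_integral_multc[symmetric]) (auto intro!: nn_integral_cong simp: algebra_simps)
    then show "(\<integral>\<^sup>+r. ?k (s - r) * (W (v + r) * ?i v) \<partial>lborel) = (\<integral>\<^sup>+r. ?k (s + v - r) * W r \<partial>lborel) * ?i v"
      using nn_integral_shift_lborel[of "\<lambda>r. ?k (s + v - r) * W r" v] by simp
  qed
  also have "\<dots> = (\<integral>\<^sup>+v. (\<lambda>u. (\<integral>\<^sup>+r. ?k (u - r) * W r \<partial>lborel) * indicator {s<..t} u) (v + s) \<partial>lborel)"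
    by (intro nn_integral_cong) (auto simp: indicator_def add.commute)
  also have "\<dots> = (\<integral>\<^sup>+u\<in>{s<..t}. (\<integral>\<^sup>+r. ?k (u - r) * W r \<partial>lborel) \<partial>lborel)"
    by (rule nn_integral_shift_lborel) measurable
  finally show ?thesis .
qed

text \<open>An increment of a convolution is the convolution of the increments of \<open>g\<close>.  If these are
  controlled by the measure with density \<open>W\<close> and atoms of mass \<open>B\<close> at the points \<open>p j\<close>, the
  increments of the fractional integral are controlled by the fractional integral of this measure,
  which has a density.  The window is \<open>{r..<r'}\<close> because the functions of interest are
  left-continuous: a jump at \<open>p j\<close> separates \<open>p j\<close> from the points to its right.\<close>

lemma rl_integral_variation:
  fixes g :: "real \<Rightarrow> 'a::euclidean_space" and W :: "real \<Rightarrow> ennreal" and p :: "'i \<Rightarrow> real"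
  assumes a: "0 < a" and F: "finite F" and st: "s < t"
    and W [measurable]: "W \<in> borel_measurable borel"
    and g [measurable]: "g \<in> borel_measurable borel"
    and int: "\<And>t. integrable lborel (\<lambda>s. rl_kernel a (t - s) *\<^sub>R g s)"
    and var: "\<And>r r'. r < r' \<Longrightarrow> ennreal (norm (g r' - g r))
        \<le> (\<integral>\<^sup>+u\<in>{r<..r'}. W u \<partial>lborel) + (\<Sum>j\<in>F. B * indicator {r..<r'} (p j))"
  shows "ennreal (norm (rl_integral a g t - rl_integral a g s))
      \<le> (\<integral>\<^sup>+u\<in>{s<..t}. ((\<integral>\<^sup>+r. ennreal (rl_kernel a (u - r)) * W r \<partial>lborel)
            + (\<Sum>j\<in>F. B * ennreal (rl_kernel a (u - p j)))) \<partial>lborel)"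
proof -
  let ?k = "\<lambda>x. ennreal (rl_kernel a x)"
  define h where "h = t - s"
  have h: "0 < h" "t = s + h" using st by (auto simp: h_def)
  have "integrable lborel (\<lambda>r. rl_kernel a (t - (h + 1 * r)) *\<^sub>R g (h + 1 * r))"
    by (rule lborel_integrable_real_affine[OF int]) simp
  then have i1: "integrable lborel (\<lambda>r. rl_kernel a (s - r) *\<^sub>R g (r + h))"
    by (simp add: h algebra_simps)
  have "rl_integral a g t - rl_integral a g s = (\<integral>r. rl_kernel a (s - r) *\<^sub>R (g (r + h) - g r) \<partial>lborel)"
    using i1 int[of s] unfolding h(2) rl_integral_shift
    by (simp add: rl_integral_def scaleR_diff_right)
  moreover have "integrable lborel (\<lambda>r. rl_kernel a (s - r) *\<^sub>R (g (r + h) - g r))"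
    using i1 int[of s] by (simp add: scaleR_diff_right)
  ultimately have "ennreal (norm (rl_integral a g t - rl_integral a g s))
      \<le> (\<integral>\<^sup>+r. ennreal (norm (rl_kernel a (s - r) *\<^sub>R (g (r + h) - g r))) \<partial>lborel)"
    by (simp only: integral_norm_bound_ennreal)
  also have "\<dots> = (\<integral>\<^sup>+r. ?k (s - r) * ennreal (norm (g (r + h) - g r)) \<partial>lborel)"
    using a by (intro nn_integral_cong) (simp add: ennreal_mult'[symmetric] rl_kernel_nonneg)
  also have "\<dots> \<le> (\<integral>\<^sup>+r. ?k (s - r) * ((\<integral>\<^sup>+u\<in>{r<..r + h}. W u \<partial>lborel) + (\<Sum>j\<in>F. B * indicator {r..<r + h} (p j))) \<partial>lborel)"
    using h by (intro nn_integral_mono mult_left_mono var) auto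
  also have "\<dots> = (\<integral>\<^sup>+r. ?k (s - r) * (\<integral>\<^sup>+u\<in>{r<..r + h}. W u \<partial>lborel)
        + (\<Sum>j\<in>F. B * (?k (s - r) * indicator {r..<r + h} (p j))) \<partial>lborel)"
    by (intro nn_integral_cong) (simp add: distrib_left sum_distrib_left mult.left_commute)
  also have "\<dots> = (\<integral>\<^sup>+r. ?k (s - r) * (\<integral>\<^sup>+u\<in>{r<..r + h}. W u \<partial>lborel) \<partial>lborel)
        + (\<Sum>j\<in>F. B * (\<integral>\<^sup>+r. ?k (s - r) * indicator {r..<r + h} (p j) \<partial>lborel))"
  proof -
    have [measurable]: "(\<lambda>r. indicator {r..<r + h} (p j) :: ennreal) \<in> borel_measurable borel" for j
    proof -
      have "(\<lambda>r. indicator {r..<r + h} (p j) :: ennreal) = indicator {p j - h<..p j}"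
        by (auto simp: indicator_def fun_eq_iff)
      then show ?thesis by simp
    qed
    have [measurable]: "(\<lambda>r. \<integral>\<^sup>+u\<in>{r<..r + h}. W u \<partial>lborel) \<in> borel_measurable borel"
    proof -
      have "(\<lambda>r. \<integral>\<^sup>+u\<in>{r<..r + h}. W u \<partial>lborel) = (\<lambda>r. \<integral>\<^sup>+u. W u * indicator {(r, u). r < u \<and> u \<le> r + h} (r, u) \<partial>lborel)"
        by (intro ext nn_integral_cong) (auto simp: indicator_def)
      then show ?thesis by simp
    qed
    show ?thesis by (simp add: nn_integral_add nn_integral_sum nn_integral_cmult)
  qed
  also have "\<dots> = (\<integral>\<^sup>+u\<in>{s<..t}. (\<integral>\<^sup>+r. ?k (u - r) * W r \<partial>lborel) \<partial>lborel)
      + (\<Sum>j\<in>F. B * (\<integral>\<^sup>+u\<in>{s<..t}. ?k (u - p j) \<partial>lborel))"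
    unfolding h_def rl_kernel_window[OF a st] rl_kernel_accumulate[OF a st W] ..
  also have "\<dots> = (\<integral>\<^sup>+u\<in>{s<..t}. ((\<integral>\<^sup>+r. ?k (u - r) * W r \<partial>lborel) + (\<Sum>j\<in>F. B * ?k (u - p j))) \<partial>lborel)"
    by (simp add: distrib_right sum_distrib_right nn_integral_add nn_integral_sum nn_integral_cmult mult.assoc)
  finally show ?thesis .
qed

section \<open>Functions whose increments are dominated by an integral\<close>

text \<open>Truncating \<open>f\<close> at a large level changes its integral by less than \<open>\<epsilon> / 2\<close>, and the integral of
  a bounded function over a small set is small.\<close>

lemma integral_absolutely_continuous:
  fixes f :: "'a \<Rightarrow> real"
  assumes f: "integrable M f" and nn: "\<And>x. 0 \<le> f x" and e: "0 < \<epsilon>"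
  obtains \<delta> where "0 < \<delta>"
    "\<And>A. A \<in> sets M \<Longrightarrow> emeasure M A < ennreal \<delta> \<Longrightarrow> (LINT x:A|M. f x) < \<epsilon>"
proof -
  have [measurable]: "f \<in> borel_measurable M" using f by simp
  have "(\<lambda>n. \<integral>x. f x - min (f x) (real n) \<partial>M) \<longlonglongrightarrow> (\<integral>x. 0 \<partial>M)"
  proof (rule integral_dominated_convergence[where w=f])
    show "AE x in M. (\<lambda>n. f x - min (f x) (real n)) \<longlonglongrightarrow> 0"
    proof (intro AE_I2 tendsto_eventually)
      fix x
      obtain N where "f x < real N" using reals_Archimedean2 by blast
      then have "f x - min (f x) (real n) = 0" if "n \<ge> N" for n
        using that by (simp add: min_def)
      then show "\<forall>\<^sub>F n in sequentially. f x - min (f x) (real n) = 0"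
        unfolding eventually_sequentially by blast
    qed
  qed (use f nn in \<open>auto simp: min_def\<close>)
  then have "\<forall>\<^sub>F n in sequentially. (\<integral>x. f x - min (f x) (real n) \<partial>M) < \<epsilon> / 2"
    using e by (intro order_tendstoD) auto
  then obtain n where n: "(\<integral>x. f x - min (f x) (real n) \<partial>M) < \<epsilon> / 2"
    by (auto simp: eventually_sequentially)
  have im: "integrable M (\<lambda>x. min (f x) (real n))"
    by (rule Bochner_Integration.integrable_bound[OF f]) (use nn in auto)
  define \<delta> where "\<delta> = (\<epsilon> / 2) / (real n + 1)"
  have "real n + 1 \<noteq> 0" by linarith
  then have \<delta>n: "\<delta> * (real n + 1) = \<epsilon> / 2" unfolding \<delta>_def by (metis nonzero_eq_divide_eq)
  have "0 < \<delta>" using e by (simp add: \<delta>_def)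
  moreover have "(LINT x:A|M. f x) < \<epsilon>" if A: "A \<in> sets M" "emeasure M A < ennreal \<delta>" for A
  proof -
    have mA: "measure M A \<le> \<delta>" "emeasure M A < \<infinity>"
      using A(2) \<open>0 < \<delta>\<close> by (auto simp: measure_def less_top[symmetric] enn2real_leI less_imp_le)
    have ind: "integrable M (\<lambda>x. indicator A x * real n)"
      using A(1) mA(2) by simp
    have "(LINT x:A|M. f x) \<le> (\<integral>x. (f x - min (f x) (real n)) + indicator A x * real n \<partial>M)"
      unfolding set_lebesgue_integral_def
      using f im ind A(1) nn by (intro integral_mono integrable_mult_indicator) (auto simp: indicator_def)
    also have "\<dots> = (\<integral>x. f x - min (f x) (real n) \<partial>M) + measure M A * real n"
      using f im ind A(1) by (subst Bochner_Integration.integral_add) auto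
    also have "\<dots> < \<epsilon> / 2 + \<epsilon> / 2"
    proof (rule add_less_le_mono[OF n])
      have "measure M A * real n \<le> \<delta> * (real n + 1)"
        using mA(1) \<open>0 < \<delta>\<close> by (intro mult_mono) auto
      also have "\<dots> = \<epsilon> / 2" by (rule \<delta>n)
      finally show "measure M A * real n \<le> \<epsilon> / 2" .
    qed
    finally show ?thesis by simp
  qed
  ultimately show thesis by (rule that)
qed

lemma set_integrable_lborel_borel:
  fixes f :: "real \<Rightarrow> 'b::euclidean_space"
  assumes "integrable lborel f" "A \<in> sets borel"
  shows "set_integrable lborel A f"
  using integrable_mult_indicator[of A lborel f] assms by (simp add: set_integrable_def)

text \<open>Half-open intervals whose interiors are disjoint are disjoint, so the dominating integrals add
  up to one integral over a set of small measure.\<close>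

lemma abs_continuous_on_integral_bound:
  fixes f :: "real \<Rightarrow> 'a::real_normed_vector"
  assumes Y: "integrable lborel Y" "\<And>u. 0 \<le> Y u"
    and bound: "\<And>a b. a < b \<Longrightarrow> {a..b} \<subseteq> S \<Longrightarrow> norm (f b - f a) \<le> (LINT u:{a<..b}|lborel. Y u)"
  shows "abs_continuous_on S f"
  unfolding abs_continuous_on_def
proof (intro allI impI)
  fix \<epsilon> :: real assume "0 < \<epsilon>"
  then obtain \<delta> where \<delta>: "0 < \<delta>"
    "\<And>A. A \<in> sets lborel \<Longrightarrow> emeasure lborel A < ennreal \<delta> \<Longrightarrow> (LINT x:A|lborel. Y x) < \<epsilon>"
    using integral_absolutely_continuous[OF Y(1) Y(2)] by metis
  show "\<exists>\<delta>>0. \<forall>D. finite D \<and> (\<forall>(a, b)\<in>D. a < b \<and> {a..b} \<subseteq> S) \<and>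
        (\<forall>p\<in>D. \<forall>q\<in>D. p \<noteq> q \<longrightarrow> {fst p<..<snd p} \<inter> {fst q<..<snd q} = {}) \<and>
        (\<Sum>(a, b)\<in>D. b - a) < \<delta> \<longrightarrow> (\<Sum>(a, b)\<in>D. norm (f b - f a)) < \<epsilon>"
  proof (intro exI[of _ \<delta>] conjI allI impI \<delta>(1), elim conjE)
    fix D :: "(real \<times> real) set"
    assume fin: "finite D" and D: "\<forall>(a, b)\<in>D. a < b \<and> {a..b} \<subseteq> S"
      and disj: "\<forall>p\<in>D. \<forall>q\<in>D. p \<noteq> q \<longrightarrow> {fst p<..<snd p} \<inter> {fst q<..<snd q} = {}"
      and len: "(\<Sum>(a, b)\<in>D. b - a) < \<delta>"
    define I where "I p = {fst p<..snd p}" for p :: "real \<times> real"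
    have Is [simp]: "I p \<in> sets borel" for p by (simp add: I_def)
    have dI: "disjoint_family_on I D"
      unfolding disjoint_family_on_def
    proof (intro ballI impI)
      fix p q assume pq: "p \<in> D" "q \<in> D" "p \<noteq> q"
      show "I p \<inter> I q = {}"
      proof (rule ccontr)
        assume "I p \<inter> I q \<noteq> {}"
        then have "max (fst p) (fst q) < min (snd p) (snd q)" by (auto simp: I_def)
        then obtain w where "max (fst p) (fst q) < w" "w < min (snd p) (snd q)" using dense by blast
        then have "w \<in> {fst p<..<snd p} \<inter> {fst q<..<snd q}" by auto
        with disj pq show False by blast
      qed
    qed
    have "emeasure lborel (\<Union>p\<in>D. I p) = (\<Sum>p\<in>D. emeasure lborel (I p))"
      using fin dI by (subst sum_emeasure) auto
    also have "\<dots> = (\<Sum>p\<in>D. ennreal (snd p - fst p))"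
      using D by (intro sum.cong) (auto simp: I_def)
    also have "\<dots> = ennreal (\<Sum>p\<in>D. snd p - fst p)"
      using D by (intro sum_ennreal) auto
    also have "\<dots> < ennreal \<delta>"
      using len \<delta>(1) by (intro ennreal_lessI) (auto simp: case_prod_unfold)
    finally have small: "(LINT x:(\<Union>p\<in>D. I p)|lborel. Y x) < \<epsilon>"
      using fin by (intro \<delta>(2)) auto
    have "(\<Sum>(a, b)\<in>D. norm (f b - f a)) \<le> (\<Sum>p\<in>D. LINT x:I p|lborel. Y x)"
      using D bound unfolding case_prod_unfold I_def by (intro sum_mono) auto
    also have "\<dots> = (LINT x:(\<Union>p\<in>D. I p)|lborel. Y x)"
      using fin dI Y(1)
      by (intro set_integral_finite_Union[symmetric] set_integrable_lborel_borel) auto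
    finally show "(\<Sum>(a, b)\<in>D. norm (f b - f a)) < \<epsilon>" using small by simp
  qed
qed

lemma continuous_on_integral_bound:
  fixes f :: "real \<Rightarrow> 'a::real_normed_vector"
  assumes Y: "integrable lborel Y" "\<And>u. 0 \<le> Y u"
    and bound: "\<And>a b. a < b \<Longrightarrow> norm (f b - f a) \<le> (LINT u:{a<..b}|lborel. Y u)"
  shows "continuous_on UNIV f"
  unfolding continuous_on_iff
proof (intro ballI allI impI)
  fix x \<epsilon> :: real assume "0 < \<epsilon>"
  then obtain \<delta> where \<delta>: "0 < \<delta>"
    "\<And>A. A \<in> sets lborel \<Longrightarrow> emeasure lborel A < ennreal \<delta> \<Longrightarrow> (LINT x:A|lborel. Y x) < \<epsilon>"
    using integral_absolutely_continuous[OF Y(1) Y(2)] by metis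
  have *: "norm (f b - f a) < \<epsilon>" if "a < b" "b - a < \<delta>" for a b
  proof -
    have "(LINT u:{a<..b}|lborel. Y u) < \<epsilon>"
      using that \<delta>(1) by (intro \<delta>(2)) (auto intro: ennreal_lessI)
    then show ?thesis using bound[OF that(1)] by simp
  qed
  show "\<exists>d>0. \<forall>x'\<in>UNIV. dist x' x < d \<longrightarrow> dist (f x') (f x) < \<epsilon>"
  proof (intro exI[of _ \<delta>] conjI ballI impI \<delta>(1))
    fix x' assume d: "dist x' x < \<delta>"
    consider "x' < x" | "x' = x" | "x < x'" by linarith
    then show "dist (f x') (f x) < \<epsilon>"
      using d *[of x x'] *[of x' x] \<open>0 < \<epsilon>\<close>
      by cases (auto simp: dist_norm norm_minus_commute)
  qed
qed

text \<open>The functions \<open>\<Phi> + h\<close> and \<open>\<Phi> - h\<close>, where \<open>\<Phi>\<close> is the primitive of \<open>Y\<close>, are increasing.  Their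
  Stieltjes measures add up to the measure with density \<open>2 Y\<close>; hence the first is absolutely
  continuous and has a density, from which that of \<open>h\<close> is obtained by subtracting \<open>Y\<close>.\<close>

lemma integral_representation_real:
  fixes h :: "real \<Rightarrow> real"
  assumes Y: "integrable lborel Y" "\<And>u. 0 \<le> Y u"
    and bound: "\<And>a b. a < b \<Longrightarrow> \<bar>h b - h a\<bar> \<le> (LINT u:{a<..b}|lborel. Y u)"
  obtains z where "integrable lborel z" "\<And>a b. a \<le> b \<Longrightarrow> h b - h a = (LINT u:{a<..b}|lborel. z u)"
proof -
  have Ym [measurable]: "Y \<in> borel_measurable borel" using Y(1) by auto
  note si = set_integrable_lborel_borel
  define \<Phi> where "\<Phi> t = (LINT u:{..t}|lborel. Y u)" for t
  have \<Phi>: "\<Phi> b - \<Phi> a = (LINT u:{a<..b}|lborel. Y u)" if "a \<le> b" for a b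
  proof -
    have "{..b} = {..a} \<union> {a<..b}" using that by auto
    then have "\<Phi> b = \<Phi> a + (LINT u:{a<..b}|lborel. Y u)"
      unfolding \<Phi>_def by (simp only:) (intro set_integral_Un si Y; auto)
    then show ?thesis by simp
  qed
  define H G where "H t = \<Phi> t + h t" and "G t = \<Phi> t - h t" for t
  have mono: "a \<le> b \<Longrightarrow> H a \<le> H b" "a \<le> b \<Longrightarrow> G a \<le> G b" for a b
    using \<Phi>[of a b] bound[of a b] by (cases "a = b"; simp add: H_def G_def abs_le_iff)+
  have Y2: "integrable lborel (\<lambda>u. 2 * Y u)" "\<And>u. 0 \<le> 2 * Y u" using Y by auto
  have HG: "H b - H a + (G b - G a) = (LINT u:{a<..b}|lborel. 2 * Y u)" if "a \<le> b" for a b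
    using \<Phi>[OF that] by (simp add: H_def G_def)
  have cont: "continuous_on UNIV H" "continuous_on UNIV G"
    using mono HG by (intro continuous_on_integral_bound[OF Y2]; smt (verit) real_norm_def)+
  then have rc: "continuous (at_right a) H" "continuous (at_right a) G" for a
    by (auto simp: continuous_on_eq_continuous_at intro: continuous_at_imp_continuous_at_within)
  define \<mu> \<nu> where "\<mu> = interval_measure H" and "\<nu> = interval_measure G"
  define \<rho> where "\<rho> = density lborel (\<lambda>u. ennreal (2 * Y u))"
  have \<mu>: "emeasure \<mu> {a<..b} = ennreal (H b - H a)" if "a \<le> b" for a b
    unfolding \<mu>_def using that mono(1) rc(1) by (rule emeasure_interval_measure_Ioc)
  have \<nu>: "emeasure \<nu> {a<..b} = ennreal (G b - G a)" if "a \<le> b" for a b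
    unfolding \<nu>_def using that mono(2) rc(2) by (rule emeasure_interval_measure_Ioc)
  have [measurable_cong, simp]: "sets \<mu> = sets borel" "sets \<nu> = sets borel" "sets \<rho> = sets borel"
    by (auto simp: \<mu>_def \<nu>_def \<rho>_def)
  have \<rho>: "emeasure \<rho> {a<..b} = ennreal (LINT u:{a<..b}|lborel. 2 * Y u)" for a b
  proof -
    have "emeasure \<rho> {a<..b} = (\<integral>\<^sup>+u. ennreal (indicator {a<..b} u * (2 * Y u)) \<partial>lborel)"
      unfolding \<rho>_def by (subst emeasure_density) (auto intro!: nn_integral_cong simp: indicator_def)
    also have "\<dots> = ennreal (\<integral>u. indicator {a<..b} u * (2 * Y u) \<partial>lborel)"
      using si[OF Y2(1), of "{a<..b}"] Y(2)
      by (intro nn_integral_eq_integral) (auto simp: set_integrable_def)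
    finally show ?thesis by (simp only: set_lebesgue_integral_def real_scaleR_def)
  qed
  \<comment> \<open>The sum of the two Stieltjes measures; it is identified with \<open>\<rho>\<close> on half-open intervals.\<close>
  define M where "M = measure_of UNIV (sets borel) (\<lambda>A. emeasure \<mu> A + emeasure \<nu> A)"
  have sM: "sets M = sets borel"
    unfolding M_def by (metis sets.sets_measure_of_eq space_borel)
  have M: "emeasure M A = emeasure \<mu> A + emeasure \<nu> A" if "A \<in> sets borel" for A
  proof (rule emeasure_measure_of[OF M_def])
    show "countably_additive (sets M) (\<lambda>A. emeasure \<mu> A + emeasure \<nu> A)"
      unfolding sM countably_additive_def
    proof (intro allI impI)
      fix A :: "nat \<Rightarrow> real set" assume A: "range A \<subseteq> sets borel" "disjoint_family A"
      then show "(\<Sum>i. emeasure \<mu> (A i) + emeasure \<nu> (A i)) = emeasure \<mu> (\<Union>(range A)) + emeasure \<nu> (\<Union>(range A))"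
        by (subst suminf_add[symmetric]) (auto simp: suminf_emeasure)
    qed
  qed (use that sM in \<open>auto simp: positive_def\<close>)
  have "M = \<rho>"
  proof (rule measure_eqI_generator_eq)
    let ?E = "range (\<lambda>(a, b). {a<..b::real})"
    show "Int_stable ?E"
      by (auto simp: Int_stable_def)
    show "emeasure M X = emeasure \<rho> X" if XE: "X \<in> ?E" for X
    proof -
      obtain p where "X = (\<lambda>(a, b). {a<..b}) p" using XE by (rule imageE)
      then obtain a b where X: "X = {a<..b}" by (cases p) simp
      show ?thesis
      proof (cases "a \<le> b")
        case True
        then show ?thesis
          using mono HG[OF True] by (simp add: X M \<mu> \<nu> \<rho> ennreal_plus[symmetric] del: ennreal_plus)
      qed (simp add: X)
    qed
    show "sets M = sigma_sets UNIV ?E" "sets \<rho> = sigma_sets UNIV ?E"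
      by (simp_all add: sM borel_sigma_sets_Ioc)
    show "range (\<lambda>i. {- real i<..real i}) \<subseteq> ?E" by auto
    show "(\<Union>i. {- real i<..real i}) = UNIV"
    proof (intro set_eqI iffI UNIV_I)
      fix x :: real
      obtain n where "\<bar>x\<bar> < real n" using reals_Archimedean2 by blast
      then show "x \<in> (\<Union>i. {- real i<..real i})" by (intro UN_I[of n]) auto
    qed
    show "emeasure M {- real i<..real i} \<noteq> \<infinity>" for i
      by (simp add: M \<mu> \<nu>)
  qed auto
  then have le: "emeasure \<mu> A \<le> emeasure \<rho> A" if "A \<in> sets borel" for A
    using M[OF that] by simp
  have "absolutely_continuous lborel \<mu>"
    unfolding absolutely_continuous_def
  proof
    fix A :: "real set" assume A: "A \<in> null_sets lborel"
    then have "AE x in lborel. x \<notin> A" by (rule AE_not_in)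
    moreover have "A \<in> sets borel" using A by auto
    ultimately have "emeasure \<rho> A = 0"
      unfolding \<rho>_def by (subst emeasure_density) (auto simp: nn_integral_0_iff_AE)
    then show "A \<in> null_sets \<mu>" using le[of A] \<open>A \<in> sets borel\<close> by (auto simp: null_sets_def)
  qed
  then obtain f where f [measurable]: "f \<in> borel_measurable lborel" and df: "density lborel f = \<mu>"
    using sigma_finite_measure.Radon_Nikodym[OF sigma_finite_lborel, of \<mu>] by auto
  have "(\<integral>\<^sup>+u. f u \<partial>lborel) = emeasure \<mu> UNIV"
    unfolding df[symmetric] by (subst emeasure_density) auto
  also have "\<dots> \<le> emeasure \<rho> UNIV" by (rule le) simp
  also have "\<dots> = (\<integral>\<^sup>+u. ennreal (2 * Y u) \<partial>lborel)"
    unfolding \<rho>_def by (subst emeasure_density) auto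
  also have "\<dots> < \<infinity>"
    using nn_integral_eq_integral[OF Y2(1)] Y(2) by simp
  finally have ffin: "(\<integral>\<^sup>+u. f u \<partial>lborel) < \<infinity>" .
  then have fae: "AE u in lborel. f u \<noteq> \<infinity>"
    by (intro nn_integral_noteq_infinite) auto
  define z where "z u = enn2real (f u) - Y u" for u
  have "(\<integral>\<^sup>+u. ennreal (enn2real (f u)) \<partial>lborel) = (\<integral>\<^sup>+u. f u \<partial>lborel)"
    using fae by (intro nn_integral_cong_AE) (auto elim!: eventually_mono simp: less_top)
  then have fi: "integrable lborel (\<lambda>u. enn2real (f u))"
    using ffin by (simp add: integrable_iff_bounded)
  show thesis
  proof (rule that)
    show "integrable lborel z" unfolding z_def[abs_def] using fi Y(1) by simp
    fix a b :: real assume ab: "a \<le> b"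
    have "ennreal (H b - H a) = (\<integral>\<^sup>+u. f u * indicator {a<..b} u \<partial>lborel)"
      using \<mu>[OF ab] unfolding df[symmetric] by (subst (asm) emeasure_density) auto
    also have "\<dots> = (\<integral>\<^sup>+u. ennreal (indicator {a<..b} u * enn2real (f u)) \<partial>lborel)"
      using fae by (intro nn_integral_cong_AE) (auto elim!: eventually_mono simp: less_top indicator_def)
    also have "\<dots> = ennreal (LINT u:{a<..b}|lborel. enn2real (f u))"
      using si[OF fi, of "{a<..b}"] unfolding set_lebesgue_integral_def real_scaleR_def
      by (intro nn_integral_eq_integral) (auto simp: set_integrable_def)
    finally have "H b - H a = (LINT u:{a<..b}|lborel. enn2real (f u))"
      using mono(1)[OF ab] by (subst (asm) ennreal_inj) (auto simp: set_lebesgue_integral_def)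
    then show "h b - h a = (LINT u:{a<..b}|lborel. z u)"
      using \<Phi>[OF ab] unfolding z_def
      by (subst set_integral_diff) (auto simp: H_def intro: si fi Y)
  qed
qed

lemma integral_representation:
  fixes h :: "real \<Rightarrow> 'a::euclidean_space"
  assumes Y: "integrable lborel Y" "\<And>u. 0 \<le> Y u"
    and bound: "\<And>a b. a < b \<Longrightarrow> norm (h b - h a) \<le> (LINT u:{a<..b}|lborel. Y u)"
  obtains z where "integrable lborel z" "\<And>a b. a \<le> b \<Longrightarrow> h b - h a = (LINT u:{a<..b}|lborel. z u)"
proof -
  have "\<exists>z. integrable lborel z \<and> (\<forall>a b. a \<le> b \<longrightarrow> h b \<bullet> i - h a \<bullet> i = (LINT u:{a<..b}|lborel. z u))"
    if i: "i \<in> Basis" for i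
  proof -
    have "\<bar>h b \<bullet> i - h a \<bullet> i\<bar> \<le> (LINT u:{a<..b}|lborel. Y u)" if "a < b" for a b
      using Basis_le_norm[OF i, of "h b - h a"] bound[OF that] by (simp add: inner_diff_left)
    then show ?thesis using integral_representation_real[OF Y, of "\<lambda>t. h t \<bullet> i"] by metis
  qed
  then obtain z where z: "\<And>i. i \<in> Basis \<Longrightarrow> integrable lborel (z i)"
    "\<And>i a b. i \<in> Basis \<Longrightarrow> a \<le> b \<Longrightarrow> h b \<bullet> i - h a \<bullet> i = (LINT u:{a<..b}|lborel. z i u)"
    by metis
  show thesis
  proof (rule that)
    show "integrable lborel (\<lambda>u. \<Sum>i\<in>Basis. z i u *\<^sub>R i)"
      using z(1) by (intro Bochner_Integration.integrable_sum integrable_scaleR_left) auto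
    fix a b :: real assume ab: "a \<le> b"
    have "(LINT u:{a<..b}|lborel. \<Sum>i\<in>Basis. z i u *\<^sub>R i)
        = (\<integral>u. (\<Sum>i\<in>Basis. (indicator {a<..b} u *\<^sub>R z i u) *\<^sub>R i) \<partial>lborel)"
      by (simp add: set_lebesgue_integral_def scaleR_sum_right)
    also have "\<dots> = (\<Sum>i\<in>Basis. (LINT u:{a<..b}|lborel. z i u) *\<^sub>R i)"
      unfolding set_lebesgue_integral_def
      using set_integrable_lborel_borel[OF z(1), of _ "{a<..b}", unfolded set_integrable_def]
      by (subst Bochner_Integration.integral_sum) (auto intro!: integrable_scaleR_left simp del: scaleR_scaleR)
    also have "\<dots> = (\<Sum>i\<in>Basis. ((h b - h a) \<bullet> i) *\<^sub>R i)"
      by (intro sum.cong) (auto simp: z(2)[symmetric] ab inner_diff_left)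
    finally show "h b - h a = (LINT u:{a<..b}|lborel. \<Sum>i\<in>Basis. z i u *\<^sub>R i)"
      by (simp add: euclidean_representation)
  qed
qed

section \<open>Differentiation of indefinite integrals almost everywhere\<close>

text \<open>The core of Lebesgue's differentiation theorem.  The exceptional set is covered, in the sense of
  Vitali, by intervals with end point \<open>x\<close> on which the difference quotient of \<open>F\<close> deviates from
  \<open>f x\<close> by more than \<open>\<epsilon>\<close>.  A disjoint subfamily is a fine tagged partial division, so Henstock's
  lemma bounds its total length by \<open>\<eta>\<close>.\<close>

lemma negligible_straddle_failure:
  fixes f :: "real \<Rightarrow> 'a::euclidean_space"
  assumes f: "f integrable_on {a..b}" and e: "0 < \<epsilon>"
  defines "F \<equiv> \<lambda>u. integral {a..u} f"
  shows "negligible {x \<in> {a..b}. \<forall>d>0. \<exists>y\<in>{a..b}. y \<noteq> x \<and> \<bar>y - x\<bar> < d \<and>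
           \<epsilon> * \<bar>y - x\<bar> < norm (F y - F x - (y - x) *\<^sub>R f x)}" (is "negligible ?S")
  unfolding negligible_outer_le
proof (intro allI impI)
  fix \<eta> :: real assume \<eta>: "0 < \<eta>"
  have pos: "0 < \<epsilon> * \<eta>" using e \<eta> by simp
  have "f integrable_on cbox a b" using f by simp
  then obtain \<gamma> where "gauge \<gamma>" and
    \<gamma>: "\<And>p. \<lbrakk>p tagged_partial_division_of (cbox a b); \<gamma> fine p\<rbrakk> \<Longrightarrow>
             sum (\<lambda>(x,k). norm (measure lborel k *\<^sub>R f x - integral k f)) p < \<epsilon> * \<eta>"
    using Henstock_lemma[OF _ pos] by blast
  let ?I = "\<lambda>(x, y). {min x y .. max x y :: real}"
  define K where "K = {(x, y). x \<in> {a..b} \<and> y \<in> {a..b} \<and> y \<noteq> x \<and> {min x y .. max x y} \<subseteq> \<gamma> x \<and>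
     \<epsilon> * \<bar>y - x\<bar> < norm (F y - F x - (y - x) *\<^sub>R f x)}"
  \<comment> \<open>The interval between \<open>x\<close> and \<open>y\<close> as a ball, the form required by the covering theorem.\<close>
  have cb: "cball ((fst i + snd i) / 2) (\<bar>snd i - fst i\<bar> / 2) = ?I i" for i :: "real \<times> real"
  proof -
    obtain x y where i: "i = (x, y)" by (cases i)
    have "(x + y) / 2 - \<bar>y - x\<bar> / 2 = min x y" "(x + y) / 2 + \<bar>y - x\<bar> / 2 = max x y"
      by (simp_all add: min_def max_def field_simps)
    then show ?thesis by (simp add: i cball_eq_atLeastAtMost)
  qed
  obtain C where C: "countable C" "C \<subseteq> K"
      and disj: "pairwise (\<lambda>i j. disjnt (?I i) (?I j)) C"
      and neg: "negligible (?S - (\<Union>i\<in>C. ?I i))"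
  proof (rule Vitali_covering_theorem_cballs[of K "\<lambda>i. \<bar>snd i - fst i\<bar> / 2" ?S "\<lambda>i. (fst i + snd i) / 2"])
    show "0 < \<bar>snd i - fst i\<bar> / 2" if "i \<in> K" for i using that by (auto simp: K_def)
  next
    fix x d :: real assume x: "x \<in> ?S" and d: "0 < d"
    have "open (\<gamma> x)" "x \<in> \<gamma> x" using \<open>gauge \<gamma>\<close> by (auto simp: gauge_def)
    then obtain r where r: "0 < r" "ball x r \<subseteq> \<gamma> x" by (meson openE)
    have "0 < min r d" using r d by simp
    then obtain y where y: "y \<in> {a..b}" "y \<noteq> x" "\<bar>y - x\<bar> < min r d"
       "\<epsilon> * \<bar>y - x\<bar> < norm (F y - F x - (y - x) *\<^sub>R f x)"
      using x by blast
    have "{min x y .. max x y} \<subseteq> ball x r"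
      using y(3) by (auto simp: dist_real_def)
    then have "(x, y) \<in> K" using x y r(2) by (auto simp: K_def)
    moreover have "x \<in> ?I (x, y)" by auto
    moreover have "\<bar>y - x\<bar> / 2 < d" using y(2,3) by auto
    ultimately show "\<exists>i. i \<in> K \<and> x \<in> cball ((fst i + snd i) / 2) (\<bar>snd i - fst i\<bar> / 2) \<and> \<bar>snd i - fst i\<bar> / 2 < d"
      by (intro exI[of _ "(x, y)"] conjI) (simp_all only: cb, simp_all)
  qed (simp add: cb)
  have fin: "(\<Sum>i\<in>D. measure lebesgue (?I i)) \<le> \<eta>" if D: "finite D" "D \<subseteq> C" for D
  proof -
    define p where "p = (\<lambda>i. (fst i, ?I i)) ` D"
    have inj: "inj_on (\<lambda>i. (fst i, ?I i)) D"
    proof (rule inj_onI)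
      fix i j assume ij: "i \<in> D" "j \<in> D" "(fst i, ?I i) = (fst j, ?I j)"
      show "i = j"
      proof (rule ccontr)
        assume "i \<noteq> j"
        then have "disjnt (?I i) (?I j)" using pairwiseD[OF disj, of i j] ij(1,2) D(2) by (meson subsetD)
        moreover have "fst i \<in> ?I i" by (auto simp: case_prod_unfold)
        ultimately show False using ij(3) by (auto simp: disjnt_def)
      qed
    qed
    have "p tagged_partial_division_of (cbox a b)"
      unfolding tagged_partial_division_of_def
    proof (intro conjI allI impI)
      show "finite p" using D by (simp add: p_def)
    next
      fix x k assume "(x, k) \<in> p"
      then obtain y where y: "(x, y) \<in> D" "k = {min x y..max x y}" by (auto simp: p_def)
      then have "(x, y) \<in> K" using D C by auto
      then show "x \<in> k" "k \<subseteq> cbox a b"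
        using y by (auto simp: K_def)
      show "\<exists>a b. k = cbox a b"
        unfolding y(2) by (metis cbox_interval)
    next
      fix x k x' k' assume *: "(x, k) \<in> p \<and> (x', k') \<in> p \<and> (x, k) \<noteq> (x', k')"
      then obtain i j where ij: "i \<in> D" "(x, k) = (fst i, ?I i)" "j \<in> D" "(x', k') = (fst j, ?I j)"
        unfolding p_def image_iff by blast
      with * have "i \<noteq> j" by metis
      then have "disjnt (?I i) (?I j)"
        using pairwiseD[OF disj, of i j] ij(1,3) D(2) by (meson subsetD)
      then have "disjnt k k'" using ij(2,4) by simp
      then show "interior k \<inter> interior k' = {}"
        using interior_subset unfolding disjnt_def by blast
    qed
    moreover have "\<gamma> fine p"
      unfolding fine_def
    proof clarify
      fix x k z assume "(x, k) \<in> p" "z \<in> k"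
      then obtain y where y: "(x, y) \<in> D" "k = {min x y..max x y}" by (auto simp: p_def)
      then have "(x, y) \<in> K" using D C by auto
      then show "z \<in> \<gamma> x" using y \<open>z \<in> k\<close> by (auto simp: K_def)
    qed
    ultimately have "sum (\<lambda>(x,k). norm (measure lborel k *\<^sub>R f x - integral k f)) p < \<epsilon> * \<eta>"
      by (rule \<gamma>)
    then have s: "(\<Sum>i\<in>D. norm (measure lborel (?I i) *\<^sub>R f (fst i) - integral (?I i) f)) < \<epsilon> * \<eta>"
      unfolding p_def by (subst (asm) sum.reindex[OF inj]) (simp add: case_prod_unfold)
    have "\<epsilon> * measure lebesgue (?I i) \<le> norm (measure lborel (?I i) *\<^sub>R f (fst i) - integral (?I i) f)" if "i \<in> D" for i
    proof -
      obtain x y where i: "i = (x, y)" by (cases i)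
      have K: "(x, y) \<in> K" using that D C i by auto
      have add: "F v = F u + integral {u..v} f" if "a \<le> u" "u \<le> v" "v \<le> b" for u v
        unfolding F_def using that f
        by (intro Henstock_Kurzweil_Integration.integral_combine[symmetric] integrable_subinterval_real[OF f]) auto
      have "norm (F y - F x - (y - x) *\<^sub>R f x) = norm (measure lborel (?I i) *\<^sub>R f (fst i) - integral (?I i) f)"
      proof (cases "x < y")
        case True
        then show ?thesis using K add[of x y] by (simp add: i K_def norm_minus_commute)
      next
        case False
        then show ?thesis using K add[of y x] by (simp add: i K_def algebra_simps)
      qed
      moreover have "measure lebesgue (?I i) = \<bar>y - x\<bar>" by (auto simp: i)
      ultimately show ?thesis using K by (simp add: K_def)
    qed
    then have "\<epsilon> * (\<Sum>i\<in>D. measure lebesgue (?I i)) \<le> \<epsilon> * \<eta>"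
      unfolding sum_distrib_left using s by (meson less_imp_le order_trans sum_mono)
    then show ?thesis using e by simp
  qed
  let ?U = "\<Union>i\<in>C. ?I i"
  have I: "?I i \<in> lmeasurable" for i
    by (cases i) (simp add: lmeasurable_interval)
  have "measure lebesgue (\<Union>i\<in>D. ?I i) \<le> \<eta>" if D: "finite D" "D \<subseteq> C" for D
    using measure_UNION_le[OF D(1), of ?I lebesgue] fin[OF D] I by (meson fmeasurableD order_trans)
  then have U: "?U \<in> lmeasurable" "measure lebesgue ?U \<le> \<eta>"
    using I fmeasurable_UN_bound[of C ?I lebesgue \<eta>] measure_UN_bound[of C ?I lebesgue \<eta>] C(1) by blast+
  have N: "?S - ?U \<in> lmeasurable" "measure lebesgue (?S - ?U) = 0"
    using neg by (auto intro: negligible_imp_measurable negligible_imp_measure0)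
  have "measure lebesgue (?U \<union> (?S - ?U)) \<le> measure lebesgue ?U + measure lebesgue (?S - ?U)"
    using U(1) N(1) by (intro measure_Un_le fmeasurableD)
  then have le: "measure lebesgue (?U \<union> (?S - ?U)) \<le> \<eta>"
    using U(2) N(2) by linarith
  have "?S \<subseteq> ?U \<union> (?S - ?U)" by (subst Un_Diff_cancel) (rule Un_upper2)
  then show "\<exists>T. ?S \<subseteq> T \<and> T \<in> lmeasurable \<and> measure lebesgue T \<le> \<eta>"
    using fmeasurable.Un[OF U(1) N(1)] le by (intro exI conjI)
qed

lemma negligible_not_differentiable_indefinite_integral:
  fixes f :: "real \<Rightarrow> 'a::euclidean_space"
  assumes f: "f integrable_on {a..b}"
  shows "negligible {x \<in> {a<..<b}. \<not> ((\<lambda>u. integral {a..u} f) has_vector_derivative f x) (at x)}"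
proof -
  define F where "F u = integral {a..u} f" for u
  define S where "S n = {x \<in> {a..b}. \<forall>d>0. \<exists>y\<in>{a..b}. y \<noteq> x \<and> \<bar>y - x\<bar> < d \<and>
           (1 / Suc n) * \<bar>y - x\<bar> < norm (F y - F x - (y - x) *\<^sub>R f x)}" for n
  have "negligible (S n)" for n
    unfolding S_def F_def by (rule negligible_straddle_failure[OF f]) simp
  then have "negligible (\<Union>n. S n)" by (intro negligible_countable_Union) auto
  moreover have "(F has_vector_derivative f x) (at x)" if x: "x \<in> {a<..<b}" "\<forall>n. x \<notin> S n" for x
    unfolding has_vector_derivative_def has_derivative_at_alt
  proof (intro conjI allI impI)
    show "bounded_linear (\<lambda>h. h *\<^sub>R f x)" by (rule bounded_linear_scaleR_left)
  next
    fix e :: real assume "0 < e"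
    then obtain n where n: "1 / Suc n < e" using nat_approx_posE by blast
    from x(2) have "x \<notin> S n" by simp
    then obtain d where d: "0 < d" "\<And>y. y \<in> {a..b} \<Longrightarrow> y \<noteq> x \<Longrightarrow> \<bar>y - x\<bar> < d \<Longrightarrow>
        norm (F y - F x - (y - x) *\<^sub>R f x) \<le> (1 / Suc n) * \<bar>y - x\<bar>"
      using x(1) unfolding S_def by (smt (verit) mem_Collect_eq greaterThanLessThan_iff atLeastAtMost_iff)
    let ?d = "min d (min (x - a) (b - x))"
    have "norm (F y - F x - (y - x) *\<^sub>R f x) \<le> e * norm (y - x)" if "norm (y - x) < ?d" for y
    proof (cases "y = x")
      case False
      then have "norm (F y - F x - (y - x) *\<^sub>R f x) \<le> (1 / Suc n) * \<bar>y - x\<bar>"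
        using that by (intro d(2)) (auto simp: abs_less_iff)
      also have "\<dots> \<le> e * \<bar>y - x\<bar>" using n by (intro mult_right_mono) auto
      finally show ?thesis by simp
    qed simp
    then show "\<exists>d>0. \<forall>y. norm (y - x) < d \<longrightarrow> norm (F y - F x - (y - x) *\<^sub>R f x) \<le> e * norm (y - x)"
      using d(1) x(1) by (intro exI[of _ ?d]) auto
  qed
  ultimately show ?thesis
    unfolding F_def[symmetric] by (elim negligible_subset) auto
qed

text \<open>Lebesgue's differentiation theorem on the line, obtained by exhausting it with the intervals
  from \<open>- n\<close> to \<open>n\<close>.\<close>

lemma AE_has_vector_derivative_indefinite_integral:
  fixes f :: "real \<Rightarrow> 'a::euclidean_space"
  assumes f: "integrable lborel f"
  shows "AE x in lborel. ((\<lambda>u. LINT s:{..<u}|lborel. f s) has_vector_derivative f x) (at x)"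
proof -
  let ?F = "\<lambda>u. LINT s:{..<u}|lborel. f s"
  have si: "set_integrable lborel A f" if "A \<in> sets borel" for A
    using integrable_mult_indicator[OF _ f, of A] that by (simp add: set_integrable_def)
  define N where "N n = {x \<in> {- real n<..<real n}. \<not> ((\<lambda>u. integral {- real n..u} f) has_vector_derivative f x) (at x)}" for n
  have "negligible (N n)" for n
    unfolding N_def
    by (rule negligible_not_differentiable_indefinite_integral, rule set_borel_integral_eq_integral(1), rule si) simp
  then have "negligible (\<Union>n. N n)" by (intro negligible_countable_Union) auto
  then have "(\<Union>n. N n) \<in> null_sets lebesgue" by (simp add: negligible_iff_null_sets)
  then have "AE x in lebesgue. x \<notin> (\<Union>n. N n)" by (rule AE_not_in)
  then have "AE x in lborel. x \<notin> (\<Union>n. N n)" by (simp only: AE_completion_iff)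
  then show ?thesis
  proof eventually_elim
    case (elim x)
    obtain n where n: "\<bar>x\<bar> < real n" using reals_Archimedean2 by blast
    then have x: "x \<in> {- real n<..<real n}" by auto
    with elim have d: "((\<lambda>u. integral {- real n..u} f) has_vector_derivative f x) (at x)"
      by (auto simp: N_def)
    have "((\<lambda>u. ?F (- real n) + integral {- real n..u} f) has_vector_derivative f x) (at x)"
      using has_vector_derivative_add[OF has_vector_derivative_const d, of "?F (- real n)"] by simp
    then show ?case
    proof (rule has_vector_derivative_transform_within_open[of _ _ _ "{- real n<..<real n}"])
      fix u assume u: "u \<in> {- real n<..<real n}"
      have *: "{..<u} = {..<- real n} \<union> {- real n..<u}" using u by auto
      have "?F u = ?F (- real n) + (LINT s:{- real n..<u}|lborel. f s)"
        unfolding * by (rule set_integral_Un) (auto intro: si)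
      also have "(LINT s:{- real n..<u}|lborel. f s) = integral {- real n..<u} f"
        by (intro set_borel_integral_eq_integral si) simp
      also have "\<dots> = integral {- real n..u} f"
        by (rule integral_subset_negligible) (auto intro: negligible_subset[of "{u}"])
      finally show "?F (- real n) + integral {- real n..u} f = ?F u" by simp
    qed (use x in auto)
  qed
qed

section \<open>Inverting a fractional integral\<close>

lemma rl_integral_one: "rl_integral 1 z t = (LINT s:{..<t}|lborel. z s)"
  unfolding rl_integral_def set_lebesgue_integral_def
  by (intro Bochner_Integration.integral_cong) (auto simp: rl_kernel_one indicator_def)

lemma rl_integral_eq_0:
  assumes "\<And>s. s < t \<Longrightarrow> \<phi> s = 0"
  shows "rl_integral a \<phi> t = 0"
proof -
  have "(\<lambda>s. rl_kernel a (t - s) *\<^sub>R \<phi> s) = (\<lambda>_. 0)"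
    using assms by (auto simp: rl_kernel_def fun_eq_iff indicator_def)
  then show ?thesis by (simp add: rl_integral_def)
qed

lemma rl_integral_cong_past:
  assumes "\<And>s. s < t \<Longrightarrow> \<phi> s = \<psi> s"
  shows "rl_integral a \<phi> t = rl_integral a \<psi> t"
  unfolding rl_integral_def
  using assms by (intro Bochner_Integration.integral_cong) (auto simp: rl_kernel_def indicator_def)

lemma rl_kernel_le:
  assumes "1 \<le> a" "r \<le> c"
  shows "rl_kernel a r \<le> c powr (a - 1) / Gamma a"
  using assms by (auto simp: rl_kernel_def indicator_def intro!: divide_right_mono powr_mono2 divide_nonneg_pos)

text \<open>Freezing \<open>h\<close> after time \<open>T\<close> makes a bound that is known up to \<open>T\<close> hold on the whole line.\<close>

lemma variation_bound_clamp:
  fixes h :: "real \<Rightarrow> 'a::real_normed_vector"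
  assumes Y: "integrable lborel Y" "\<And>u. 0 \<le> Y u"
    and bound: "\<And>a b. a < b \<Longrightarrow> b \<le> T \<Longrightarrow> norm (h b - h a) \<le> (LINT u:{a<..b}|lborel. Y u)"
    and ab: "a < b"
  shows "norm (h (min b T) - h (min a T)) \<le> (LINT u:{a<..b}|lborel. Y u)"
proof -
  have "norm (h (min b T) - h (min a T)) \<le> (LINT u:{min a T<..min b T}|lborel. Y u)"
  proof (cases "min a T < min b T")
    case True
    then show ?thesis by (intro bound) auto
  next
    case False
    then have "min a T = min b T" using ab by auto
    then show ?thesis by (simp add: set_lebesgue_integral_def)
  qed
  also have "\<dots> \<le> (LINT u:{a<..b}|lborel. Y u)"
    unfolding set_lebesgue_integral_def
    using set_integrable_lborel_borel[OF Y(1)] Y(2) ab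
    by (intro integral_mono) (auto simp: set_integrable_def split: split_indicator)
  finally show ?thesis .
qed

lemma rl_integral_density:
  fixes g :: "real \<Rightarrow> 'a::euclidean_space"
  assumes g0: "\<And>s. s \<le> 0 \<Longrightarrow> g s = 0"
    and Y: "integrable lborel Y" "\<And>u. 0 \<le> Y u"
    and bound: "\<And>a b. a < b \<Longrightarrow> b \<le> T \<Longrightarrow> norm (rl_integral \<alpha> g b - rl_integral \<alpha> g a) \<le> (LINT u:{a<..b}|lborel. Y u)"
  obtains z where "integrable lborel z" "\<And>s. s \<notin> {0<..T} \<Longrightarrow> z s = 0"
    "\<And>t. t \<le> T \<Longrightarrow> rl_integral \<alpha> g t = rl_integral 1 z t"
proof -
  let ?y = "rl_integral \<alpha> g"
  obtain z where z: "integrable lborel z"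
    and yz: "\<And>a b. a \<le> b \<Longrightarrow> ?y (min b T) - ?y (min a T) = (LINT u:{a<..b}|lborel. z u)"
    using integral_representation[OF Y variation_bound_clamp[OF Y bound]] by blast
  have y0: "?y s = 0" if "s \<le> 0" for s
    using that g0 by (intro rl_integral_eq_0) auto
  show thesis
  proof (rule that)
    show "integrable lborel (\<lambda>s. indicator {0<..T} s *\<^sub>R z s)"
      using z by (intro integrable_mult_indicator) auto
    show "indicator {0<..T} s *\<^sub>R z s = 0" if "s \<notin> {0<..T}" for s using that by simp
    fix t assume t: "t \<le> T"
    show "?y t = rl_integral 1 (\<lambda>s. indicator {0<..T} s *\<^sub>R z s) t"
    proof (cases "0 \<le> t")
      case True
      have "?y t = (LINT u:{0<..t}|lborel. z u)" using yz[of 0 t] True t y0[of 0] by simp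
      also have "\<dots> = (LINT s:{..<t}|lborel. indicator {0<..T} s *\<^sub>R z s)"
        unfolding set_lebesgue_integral_def
      proof (rule integral_cong_AE)
        have [measurable]: "z \<in> borel_measurable borel" using z by auto
        show "(\<lambda>x. indicator {0<..t} x *\<^sub>R z x) \<in> borel_measurable lborel"
          "(\<lambda>x. indicator {..<t} x *\<^sub>R indicator {0<..T} x *\<^sub>R z x) \<in> borel_measurable lborel" by measurable
        show "AE x in lborel. indicator {0<..t} x *\<^sub>R z x = indicator {..<t} x *\<^sub>R indicator {0<..T} x *\<^sub>R z x"
          using AE_lborel_singleton[of t] by eventually_elim (use t in \<open>auto simp: indicator_def\<close>)
      qed
      finally show ?thesis by (simp add: rl_integral_one)
    next
      case False
      have "rl_integral 1 (\<lambda>s. indicator {0<..T} s *\<^sub>R z s) t = 0"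
        using False by (intro rl_integral_eq_0) auto
      then show ?thesis using False y0 by simp
    qed
  qed
qed

text \<open>The semigroup law shows that \<open>J\<^sup>1\<^sup>-\<^sup>\<alpha> z\<close> and \<open>g\<close> have the same primitive up to time \<open>T\<close>; by
  Lebesgue's differentiation theorem they agree almost everywhere.\<close>

lemma rl_integral_inversion:
  fixes g z :: "real \<Rightarrow> 'a::euclidean_space"
  assumes \<alpha>: "0 < \<alpha>" "\<alpha> < 1"
    and g: "integrable lborel g"
    and z: "integrable lborel z" and z0: "\<And>s. s \<notin> {0<..T} \<Longrightarrow> z s = 0"
    and gz: "\<And>t. t \<le> T \<Longrightarrow> rl_integral \<alpha> g t = rl_integral 1 z t"
  shows "AE v in lborel. v < T \<longrightarrow> integrable lborel (\<lambda>s. rl_kernel (1 - \<alpha>) (v - s) *\<^sub>R z s)"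
    and "AE v in lborel. v < T \<longrightarrow> rl_integral (1 - \<alpha>) z v = g v"
proof -
  have [measurable]: "g \<in> borel_measurable borel" "z \<in> borel_measurable borel" using g z by auto
  have \<beta>: "0 < 1 - \<alpha>" using \<alpha> by simp
  \<comment> \<open>The kernel of order \<open>2 - \<alpha>\<close> is bounded on the support of \<open>z\<close>.\<close>
  have int2: "integrable lborel (\<lambda>s. rl_kernel (1 + (1 - \<alpha>)) (\<tau> - s) *\<^sub>R z s)" if \<tau>: "\<tau> \<le> T" for \<tau>
  proof (rule Bochner_Integration.integrable_bound[where f="\<lambda>s. (T powr (1 - \<alpha>) / Gamma (2 - \<alpha>)) *\<^sub>R z s"])
    show "integrable lborel (\<lambda>s. (T powr (1 - \<alpha>) / Gamma (2 - \<alpha>)) *\<^sub>R z s)" using z by simp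
    show "AE s in lborel. norm (rl_kernel (1 + (1 - \<alpha>)) (\<tau> - s) *\<^sub>R z s) \<le> norm ((T powr (1 - \<alpha>) / Gamma (2 - \<alpha>)) *\<^sub>R z s)"
    proof (intro AE_I2)
      fix s
      show "norm (rl_kernel (1 + (1 - \<alpha>)) (\<tau> - s) *\<^sub>R z s) \<le> norm ((T powr (1 - \<alpha>) / Gamma (2 - \<alpha>)) *\<^sub>R z s)"
      proof (cases "s \<in> {0<..T}")
        case True
        then have "rl_kernel (1 + (1 - \<alpha>)) (\<tau> - s) \<le> T powr (1 + (1 - \<alpha>) - 1) / Gamma (1 + (1 - \<alpha>))"
          using \<alpha> \<tau> by (intro rl_kernel_le) auto
        then have "\<bar>rl_kernel (1 + (1 - \<alpha>)) (\<tau> - s)\<bar> \<le> \<bar>T powr (1 - \<alpha>) / Gamma (2 - \<alpha>)\<bar>"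
          using \<alpha> rl_kernel_nonneg[of "1 + (1 - \<alpha>)" "\<tau> - s"] by (simp add: abs_if)
        then show ?thesis unfolding norm_scaleR by (rule mult_right_mono) simp
      qed (simp add: z0)
    qed
  qed simp
  note \<tau>1 = rl_integral_semigroup[OF zero_less_one \<beta>, of z]
  note \<tau>2 = rl_integral_semigroup[OF \<beta> zero_less_one, of z]
  let ?w = "rl_integral (1 - \<alpha>) z"
  have eq: "rl_integral 1 ?w \<tau> = rl_integral 1 g \<tau>" if \<tau>: "\<tau> \<le> T" for \<tau>
  proof -
    have "rl_integral 1 ?w \<tau> = rl_integral (1 + (1 - \<alpha>)) z \<tau>"
      using int2[OF \<tau>] by (intro \<tau>1) auto
    also have "\<dots> = rl_integral (1 - \<alpha>) (rl_integral 1 z) \<tau>"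
      using int2[OF \<tau>] \<tau>2(3)[of \<tau>] by (simp add: add.commute)
    also have "\<dots> = rl_integral (1 - \<alpha>) (rl_integral \<alpha> g) \<tau>"
      using \<tau> gz by (intro rl_integral_cong_past) auto
    also have "\<dots> = rl_integral (1 - \<alpha> + \<alpha>) g \<tau>"
    proof (rule rl_integral_semigroup(3)[OF \<beta> \<alpha>(1)])
      have "(\<lambda>s. rl_kernel (1 - \<alpha> + \<alpha>) (\<tau> - s) *\<^sub>R g s) = (\<lambda>s. indicator {..<\<tau>} s *\<^sub>R g s)"
        by (auto simp: rl_kernel_one indicator_def fun_eq_iff)
      then show "integrable lborel (\<lambda>s. rl_kernel (1 - \<alpha> + \<alpha>) (\<tau> - s) *\<^sub>R g s)"
        using g by (simp add: integrable_mult_indicator)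
    qed simp
    finally show ?thesis by simp
  qed
  show "AE v in lborel. v < T \<longrightarrow> integrable lborel (\<lambda>s. rl_kernel (1 - \<alpha>) (v - s) *\<^sub>R z s)"
    using int2[of T] by (intro \<tau>1) auto
  have "integrable lborel (\<lambda>v. rl_kernel 1 (T - v) *\<^sub>R ?w v)"
    using int2[of T] by (intro \<tau>1) auto
  then have w: "integrable lborel (\<lambda>v. indicator {..<T} v *\<^sub>R ?w v)" (is "integrable _ ?w'")
    by (rule back_subst[of "integrable lborel"]) (auto simp: rl_kernel_one indicator_def fun_eq_iff)
  have eq': "(LINT s:{..<\<tau>}|lborel. ?w' s) = (LINT s:{..<\<tau>}|lborel. g s)" if "\<tau> \<le> T" for \<tau>
  proof -
    have "rl_integral 1 ?w' \<tau> = rl_integral 1 ?w \<tau>"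
      using that by (intro rl_integral_cong_past) auto
    then show ?thesis using eq[OF that] by (simp add: rl_integral_one)
  qed
  show "AE v in lborel. v < T \<longrightarrow> ?w v = g v"
    using AE_has_vector_derivative_indefinite_integral[OF w] AE_has_vector_derivative_indefinite_integral[OF g]
  proof eventually_elim
    case (elim v)
    show ?case
    proof
      assume v: "v < T"
      \<comment> \<open>The primitives coincide on the neighbourhood \<open>{..<T}\<close> of \<open>v\<close>, so both integrands are the derivative there.\<close>
      have "((\<lambda>u. LINT s:{..<u}|lborel. g s) has_vector_derivative ?w' v) (at v)"
        using elim(1) by (rule has_vector_derivative_transform_within_open[of _ _ _ "{..<T}"]) (use v eq' in auto)
      then have "?w' v = g v" using elim(2) by (rule vector_derivative_unique_at)
      then show "?w v = g v" using v by simp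
    qed
  qed
qed

section \<open>The impulsive Volterra equation and its fixed point\<close>

text \<open>The Volterra form of the impulsive system for an arbitrary Lipschitz field \<open>f\<close>.\<close>

locale impulsive_volterra =
  fixes \<alpha> T L l1 l2 :: real and m :: nat and t :: "nat \<Rightarrow> real"
    and f :: "'a::euclidean_space \<Rightarrow> 'a" and U :: "nat \<Rightarrow> 'a \<Rightarrow> 'a" and x0 :: 'a
  assumes order: "0 < \<alpha>"
    and horizon: "0 < T"
    and times: "impulse_times m T t"
    and L: "0 < L" and f_lip: "\<And>x y. norm (f x - f y) \<le> L * norm (x - y)"
    and l1: "0 \<le> l1" and U_bound: "\<And>k x. k \<in> {1..m} \<Longrightarrow> norm (U k x) \<le> l1"
    and l2: "0 \<le> l2" and U_lip: "\<And>k x y. k \<in> {1..m} \<Longrightarrow> norm (U k x - U k y) \<le> l2 * norm (x - y)"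
    and contraction: "real m * l2 < 1"
begin

lemma times_mono: "i < j \<Longrightarrow> j \<le> Suc m \<Longrightarrow> t i < t j"
proof (induction j)
  case (Suc j)
  have "t j < t (Suc j)" using times Suc.prems by (simp add: impulse_times_def)
  then show ?case using Suc by (cases "i = j") auto
qed simp

lemma times_pos: "k \<in> {1..m} \<Longrightarrow> 0 < t k"
  using times_mono[of 0 k] times by (auto simp: impulse_times_def)

definition jumps :: "(real \<Rightarrow> 'a) \<Rightarrow> real \<Rightarrow> 'a" where
  "jumps x s = (\<Sum>k\<in>{1..m}. if t k < s then U k (x (t k)) else 0)"

definition forcing :: "(real \<Rightarrow> 'a) \<Rightarrow> real \<Rightarrow> 'a" where
  "forcing x s = indicator {0<..T} s *\<^sub>R f (x s)"

definition picard :: "(real \<Rightarrow> 'a) \<Rightarrow> real \<Rightarrow> 'a" where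
  "picard x s = x0 + jumps x s + rl_integral \<alpha> (forcing x) s"

text \<open>The factor by which \<open>J\<^sup>\<alpha>\<close> scales the weight, chosen such that \<open>m l2 + L \<omega>\<close> lies halfway
  between \<open>m l2\<close> and \<open>1\<close>; the exponent \<open>\<theta>\<close> below is the one that realises it.\<close>

definition \<omega> :: real where "\<omega> = (1 - real m * l2) / (2 * L)"

definition \<theta> :: real where "\<theta> = \<omega> powr (- 1 / \<alpha>)"

definition q :: real where "q = real m * l2 + L * \<omega>"

text \<open>The fixed point of the affine map that bounds the radius of \<open>picard x\<close> around \<open>x0\<close> in terms of
  the radius of \<open>x\<close>, so that the ball of this radius is mapped into itself.\<close>

definition R :: real where "R = (real m * l1 + norm (f x0) * \<omega>) / (1 - L * \<omega>)"

definition admissible :: "(real \<Rightarrow> 'a) \<Rightarrow> bool" where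
  "admissible x \<longleftrightarrow> x \<in> borel_measurable borel \<and> (\<forall>s. norm (x s - x0) \<le> R * exp (\<theta> * s))"

lemma \<omega>_pos: "0 < \<omega>"
  using contraction L by (simp add: \<omega>_def)

lemma \<theta>_pos: "0 < \<theta>"
  using \<omega>_pos by (simp add: \<theta>_def)

lemma \<theta>_\<omega>: "\<theta> powr - \<alpha> = \<omega>"
  using \<omega>_pos order by (simp add: \<theta>_def powr_powr)

lemma q: "0 \<le> q" "q < 1" and L\<omega>: "0 < L * \<omega>" "L * \<omega> < 1"
proof -
  define p where "p = real m * l2"
  have "0 \<le> p" "p < 1" using l2 contraction by (simp_all add: p_def)
  moreover have "L * \<omega> = (1 - p) / 2" using L by (simp add: \<omega>_def p_def)
  ultimately show "0 \<le> q" "q < 1" "0 < L * \<omega>" "L * \<omega> < 1"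
    by (simp_all add: q_def p_def[symmetric])
qed

lemma R_nonneg: "0 \<le> R"
  using l1 \<omega>_pos L\<omega> by (simp add: R_def)

lemma f_measurable [measurable]: "f \<in> borel_measurable borel"
proof (intro borel_measurable_continuous_onI lipschitz_on_continuous_on lipschitz_onI)
  show "dist (f x) (f y) \<le> L * dist x y" for x y using f_lip by (simp add: dist_norm)
qed (use L in simp)

lemma admissible_measurable: "admissible x \<Longrightarrow> x \<in> borel_measurable borel"
  by (simp add: admissible_def)

lemma forcing_measurable: "x \<in> borel_measurable borel \<Longrightarrow> forcing x \<in> borel_measurable borel"
  unfolding forcing_def[abs_def] by measurable

lemma forcing_exp_bound:
  assumes x: "admissible x"
  shows "norm (forcing x s) \<le> (norm (f x0) + L * R) * exp (\<theta> * s)"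
proof (cases "s \<in> {0<..T}")
  case True
  have "norm (f (x s)) \<le> norm (f x0) + norm (f (x s) - f x0)"
    by (metis add.commute diff_add_cancel norm_triangle_ineq)
  also have "\<dots> \<le> norm (f x0) * exp (\<theta> * s) + L * (R * exp (\<theta> * s))"
  proof (intro add_mono)
    have "norm (f x0) * 1 \<le> norm (f x0) * exp (\<theta> * s)"
      using True \<theta>_pos by (intro mult_left_mono) auto
    then show "norm (f x0) \<le> norm (f x0) * exp (\<theta> * s)" by simp
    show "norm (f (x s) - f x0) \<le> L * (R * exp (\<theta> * s))"
      using x L by (intro order_trans[OF f_lip] mult_left_mono) (auto simp: admissible_def)
  qed
  finally show ?thesis using True by (simp add: forcing_def algebra_simps)
next
  case False
  then show ?thesis using L R_nonneg by (auto simp: forcing_def intro!: mult_nonneg_nonneg add_nonneg_nonneg)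
qed

definition M :: real where "M = (norm (f x0) + L * R) * exp (\<theta> * T)"

lemma forcing_bound:
  assumes x: "admissible x"
  shows "norm (forcing x s) \<le> M"
proof (cases "s \<le> T")
  case True
  have "norm (forcing x s) \<le> (norm (f x0) + L * R) * exp (\<theta> * s)" by (rule forcing_exp_bound[OF x])
  also have "\<dots> \<le> M" unfolding M_def
    using True \<theta>_pos L R_nonneg by (intro mult_left_mono) auto
  finally show ?thesis .
next
  case False
  then show ?thesis using L R_nonneg by (auto simp: forcing_def M_def intro!: mult_nonneg_nonneg add_nonneg_nonneg)
qed

lemma forcing_integrable:
  assumes x: "admissible x"
  shows "integrable lborel (\<lambda>r. rl_kernel \<alpha> (s - r) *\<^sub>R forcing x r)"
  using order \<theta>_pos forcing_measurable[OF admissible_measurable[OF x]] forcing_exp_bound[OF x]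
  by (rule rl_integral_exp_bound(1))

lemma admissible_picard:
  assumes x: "admissible x"
  shows "admissible (picard x)"
  unfolding admissible_def
proof (intro conjI allI)
  note [measurable] = admissible_measurable[OF x] forcing_measurable[OF admissible_measurable[OF x]]
  show "picard x \<in> borel_measurable borel"
    unfolding picard_def[abs_def] jumps_def[abs_def] by measurable
  fix s
  have "norm (jumps x s) \<le> (\<Sum>k\<in>{1..m}. l1 * exp (\<theta> * s))"
    unfolding jumps_def
  proof (rule sum_norm_le)
    fix k assume k: "k \<in> {1..m}"
    show "norm (if t k < s then U k (x (t k)) else 0) \<le> l1 * exp (\<theta> * s)"
    proof (cases "t k < s")
      case True
      then have "l1 * 1 \<le> l1 * exp (\<theta> * s)"
        using times_pos[OF k] \<theta>_pos l1 by (intro mult_left_mono) auto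
      then show ?thesis using True U_bound[OF k, of "x (t k)"] by simp
    qed (use l1 in simp)
  qed
  moreover have "norm (rl_integral \<alpha> (forcing x) s) \<le> (norm (f x0) + L * R) * \<omega> * exp (\<theta> * s)"
    using rl_integral_exp_bound(2)[OF order \<theta>_pos forcing_measurable[OF admissible_measurable[OF x]] forcing_exp_bound[OF x]]
    by (simp add: \<theta>_\<omega>)
  moreover have "norm (picard x s - x0) \<le> norm (jumps x s) + norm (rl_integral \<alpha> (forcing x) s)"
    by (simp add: picard_def add.assoc norm_triangle_ineq)
  ultimately have "norm (picard x s - x0) \<le> (real m * l1 + (norm (f x0) + L * R) * \<omega>) * exp (\<theta> * s)"
    by (simp add: algebra_simps)
  also have "real m * l1 + (norm (f x0) + L * R) * \<omega> = R"
  proof -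
    have "R * (1 - L * \<omega>) = real m * l1 + norm (f x0) * \<omega>" using L\<omega> by (simp add: R_def)
    then show ?thesis by (simp add: algebra_simps)
  qed
  finally show "norm (picard x s - x0) \<le> R * exp (\<theta> * s)" .
qed

text \<open>Jumps before time \<open>s\<close> are compared where the weight is smaller, and fractional integration
  multiplies the weight by \<open>\<omega>\<close>.\<close>

lemma picard_contraction:
  assumes x: "admissible x" and y: "admissible y"
    and xy: "\<And>s. norm (x s - y s) \<le> C * exp (\<theta> * s)"
  shows "norm (picard x s - picard y s) \<le> q * C * exp (\<theta> * s)"
proof -
  have C: "0 \<le> C" using order_trans[OF norm_ge_zero xy, of 0] by simp
  have "norm (jumps x s - jumps y s) \<le> (\<Sum>k\<in>{1..m}. l2 * (C * exp (\<theta> * s)))"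
    unfolding jumps_def sum_subtractf[symmetric]
  proof (rule sum_norm_le)
    fix k assume k: "k \<in> {1..m}"
    show "norm ((if t k < s then U k (x (t k)) else 0) - (if t k < s then U k (y (t k)) else 0)) \<le> l2 * (C * exp (\<theta> * s))"
    proof (cases "t k < s")
      case True
      have "norm (x (t k) - y (t k)) \<le> C * exp (\<theta> * t k)" by (rule xy)
      also have "\<dots> \<le> C * exp (\<theta> * s)" using True \<theta>_pos C by (intro mult_left_mono) auto
      finally have "l2 * norm (x (t k) - y (t k)) \<le> l2 * (C * exp (\<theta> * s))" using l2 by (rule mult_left_mono)
      then show ?thesis using True U_lip[OF k, of "x (t k)" "y (t k)"] by simp
    qed (use l2 C in simp)
  qed
  moreover have "norm (rl_integral \<alpha> (forcing x) s - rl_integral \<alpha> (forcing y) s) \<le> L * C * \<omega> * exp (\<theta> * s)"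
  proof -
    have "rl_integral \<alpha> (forcing x) s - rl_integral \<alpha> (forcing y) s = rl_integral \<alpha> (\<lambda>r. forcing x r - forcing y r) s"
      unfolding rl_integral_def scaleR_diff_right
      using forcing_integrable[OF x] forcing_integrable[OF y] by simp
    also have "norm \<dots> \<le> L * C * \<theta> powr - \<alpha> * exp (\<theta> * s)"
    proof (rule rl_integral_exp_bound(2)[OF order \<theta>_pos])
      show "(\<lambda>r. forcing x r - forcing y r) \<in> borel_measurable borel"
        using forcing_measurable admissible_measurable x y by simp
      fix r
      have "norm (forcing x r - forcing y r) \<le> norm (f (x r) - f (y r))"
        by (auto simp: forcing_def indicator_def)
      also have "\<dots> \<le> L * (C * exp (\<theta> * r))"
        using L by (intro order_trans[OF f_lip] mult_left_mono xy) auto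
      finally show "norm (forcing x r - forcing y r) \<le> L * C * exp (\<theta> * r)" by (simp add: mult.assoc)
    qed
    finally show ?thesis by (simp add: \<theta>_\<omega>)
  qed
  moreover have "norm (picard x s - picard y s)
      \<le> norm (jumps x s - jumps y s) + norm (rl_integral \<alpha> (forcing x) s - rl_integral \<alpha> (forcing y) s)"
    unfolding picard_def by (smt (verit, ccfv_threshold) add_diff_add diff_self add_0 norm_triangle_ineq)
  ultimately show ?thesis
    by (simp add: q_def algebra_simps)
qed

definition iterate :: "nat \<Rightarrow> real \<Rightarrow> 'a" where
  "iterate n = (picard ^^ n) (\<lambda>_. x0)"

lemma iterate_0: "iterate 0 = (\<lambda>_. x0)" and iterate_Suc: "iterate (Suc n) = picard (iterate n)"
  by (simp_all add: iterate_def)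

lemma admissible_iterate: "admissible (iterate n)"
proof (induction n)
  case 0
  then show ?case using R_nonneg by (simp add: iterate_0 admissible_def)
next
  case (Suc n)
  then show ?case by (simp add: iterate_Suc admissible_picard)
qed

text \<open>The case \<open>n = 0\<close> is the radius of the invariant ball; each further application of the operator
  gains a factor \<open>q\<close>.\<close>

lemma iterate_tail: "norm (iterate (n + k) s - iterate n s) \<le> q ^ n * R * exp (\<theta> * s)"
proof (induction n arbitrary: s)
  case 0
  then show ?case using admissible_iterate[of k] by (simp add: iterate_0 admissible_def)
next
  case (Suc n)
  have "norm (picard (iterate (n + k)) s - picard (iterate n) s) \<le> q * (q ^ n * R) * exp (\<theta> * s)"
    using Suc by (intro picard_contraction admissible_iterate)
  then show ?case by (simp add: iterate_Suc mult.assoc)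
qed

definition solution :: "real \<Rightarrow> 'a" where
  "solution s = lim (\<lambda>n. iterate n s)"

lemma iterate_tendsto: "(\<lambda>n. iterate n s) \<longlonglongrightarrow> solution s"
proof -
  have "Cauchy (\<lambda>n. iterate n s)"
  proof (rule CauchyI)
    fix e :: real assume e: "0 < e"
    have "(\<lambda>n. q ^ n * (R * exp (\<theta> * s))) \<longlonglongrightarrow> 0 * (R * exp (\<theta> * s))"
      using q by (intro tendsto_mult LIMSEQ_realpow_zero tendsto_const)
    then have "\<forall>\<^sub>F n in sequentially. q ^ n * (R * exp (\<theta> * s)) < e / 2"
      using e by (intro order_tendstoD) auto
    then obtain N where "q ^ N * (R * exp (\<theta> * s)) < e / 2"
      by (auto simp: eventually_sequentially)
    then have N: "norm (iterate n s - iterate N s) < e / 2" if "n \<ge> N" for n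
      using iterate_tail[of N "n - N" s] that by (simp add: mult.assoc)
    show "\<exists>N. \<forall>i\<ge>N. \<forall>j\<ge>N. norm (iterate i s - iterate j s) < e"
    proof (intro exI allI impI)
      fix i j assume "i \<ge> N" "j \<ge> N"
      then show "norm (iterate i s - iterate j s) < e"
        using norm_triangle_lt[of "iterate i s - iterate N s" "iterate N s - iterate j s" e] N[of i] N[of j]
        by (simp add: norm_minus_commute)
    qed
  qed
  then show ?thesis
    unfolding solution_def by (simp add: Cauchy_convergent convergent_LIMSEQ_iff[symmetric])
qed

lemma solution_tail: "norm (solution s - iterate n s) \<le> q ^ n * R * exp (\<theta> * s)"
proof (rule LIMSEQ_le_const2)
  have "(\<lambda>k. iterate (k + n) s) \<longlonglongrightarrow> solution s" by (rule LIMSEQ_ignore_initial_segment[OF iterate_tendsto])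
  then show "(\<lambda>k. norm (iterate (k + n) s - iterate n s)) \<longlonglongrightarrow> norm (solution s - iterate n s)"
    by (intro tendsto_intros)
  show "\<exists>N. \<forall>k\<ge>N. norm (iterate (k + n) s - iterate n s) \<le> q ^ n * R * exp (\<theta> * s)"
    using iterate_tail[of n _ s] by (auto simp: add.commute)
qed

lemma admissible_solution: "admissible solution"
  unfolding admissible_def
proof (intro conjI allI)
  show "solution \<in> borel_measurable borel"
    using iterate_tendsto admissible_measurable[OF admissible_iterate]
    by (rule borel_measurable_LIMSEQ_metric[rotated])
  show "norm (solution s - x0) \<le> R * exp (\<theta> * s)" for s
    using solution_tail[of s 0] by (simp add: iterate_0)
qed

lemma solution_fixed_point: "picard solution = solution"
proof
  fix s
  have "(\<lambda>n. iterate (Suc n) s) \<longlonglongrightarrow> picard solution s"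
  proof (rule Lim_null_comparison[THEN LIM_zero_cancel])
    show "\<forall>\<^sub>F n in sequentially. norm (iterate (Suc n) s - picard solution s) \<le> q * (q ^ n * R) * exp (\<theta> * s)"
      unfolding iterate_Suc
      using solution_tail by (intro always_eventually allI picard_contraction admissible_iterate admissible_solution)
        (simp add: norm_minus_commute)
    have "(\<lambda>n. q * (q ^ n * R) * exp (\<theta> * s)) \<longlonglongrightarrow> q * (0 * R) * exp (\<theta> * s)"
      using q by (intro tendsto_intros LIMSEQ_realpow_zero)
    then show "(\<lambda>n. q * (q ^ n * R) * exp (\<theta> * s)) \<longlonglongrightarrow> 0" by simp
  qed
  moreover have "(\<lambda>n. iterate (Suc n) s) \<longlonglongrightarrow> solution s"
    using iterate_tendsto by (rule LIMSEQ_Suc)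
  ultimately show "picard solution s = solution s" by (rule LIMSEQ_unique)
qed

section \<open>A majorant for the variation of the Picard iterates\<close>

text \<open>Propagates a variation density \<open>W\<close> of \<open>x\<close> to one of \<open>picard x\<close>: the forcing varies at most by
  \<open>L W\<close>, and by at most \<open>2 M\<close> at each impulse time and at both end points of \<open>{0<..T}\<close>, where it is cut
  off.\<close>

definition majorant_step :: "(real \<Rightarrow> ennreal) \<Rightarrow> real \<Rightarrow> ennreal" where
  "majorant_step W u = (\<integral>\<^sup>+r. ennreal (rl_kernel \<alpha> (u - r)) * (ennreal L * W r) \<partial>lborel)
     + (\<Sum>j\<in>{..Suc m}. ennreal (2 * M) * ennreal (rl_kernel \<alpha> (u - t j)))"

text \<open>Increments are compared only over intervals free of impulse times.  Intervals starting at
  \<open>t j\<close> are excluded, since the function jumps immediately after \<open>t j\<close>, whereas intervals ending at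
  \<open>t j\<close> are allowed.\<close>

definition varies_by :: "(real \<Rightarrow> 'a) \<Rightarrow> (real \<Rightarrow> ennreal) \<Rightarrow> bool" where
  "varies_by x W \<longleftrightarrow> (\<forall>r r'. r < r' \<longrightarrow> (\<forall>j\<le>Suc m. t j \<notin> {r..<r'}) \<longrightarrow>
      ennreal (norm (x r' - x r)) \<le> (\<integral>\<^sup>+u\<in>{r<..r'}. W u \<partial>lborel))"

lemma majorant_step_measurable [measurable]:
  assumes [measurable]: "W \<in> borel_measurable borel"
  shows "majorant_step W \<in> borel_measurable borel"
  unfolding majorant_step_def[abs_def] by measurable

text \<open>Across an impulse time only the uniform bound \<open>M\<close> is available; elsewhere the cut-off does not
  change and the Lipschitz condition applies.\<close>

lemma forcing_variation:
  assumes x: "admissible x" and [measurable]: "W \<in> borel_measurable borel"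
    and var: "varies_by x W" and r: "r < r'"
  shows "ennreal (norm (forcing x r' - forcing x r))
    \<le> (\<integral>\<^sup>+u\<in>{r<..r'}. (ennreal L * W u) \<partial>lborel) + (\<Sum>j\<in>{..Suc m}. ennreal (2 * M) * indicator {r..<r'} (t j))"
proof (cases "\<exists>j\<le>Suc m. t j \<in> {r..<r'}")
  case True
  then obtain j where j: "j \<in> {..Suc m}" "t j \<in> {r..<r'}" by auto
  have "norm (forcing x r' - forcing x r) \<le> 2 * M"
    using norm_triangle_ineq4[of "forcing x r'" "forcing x r"] forcing_bound[OF x, of r] forcing_bound[OF x, of r'] by simp
  then have "ennreal (norm (forcing x r' - forcing x r)) \<le> ennreal (2 * M) * indicator {r..<r'} (t j)"
    using j(2) by (simp add: ennreal_leI)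
  also have "\<dots> \<le> (\<Sum>j\<in>{..Suc m}. ennreal (2 * M) * indicator {r..<r'} (t j))"
    using j(1) by (intro member_le_sum[of j "{..Suc m}" "\<lambda>j. ennreal (2 * M) * indicator {r..<r'} (t j)"]) auto
  finally show ?thesis by (simp add: add_increasing)
next
  case False
  then have no: "\<forall>j\<le>Suc m. t j \<notin> {r..<r'}" by blast
  from no have "t 0 \<notin> {r..<r'}" "t (Suc m) \<notin> {r..<r'}" by blast+
  then have "r \<in> {0<..T} \<longleftrightarrow> r' \<in> {0<..T}"
    using times r by (auto simp: impulse_times_def)
  then have "norm (forcing x r' - forcing x r) \<le> norm (f (x r') - f (x r))"
    by (auto simp: forcing_def indicator_def)
  also have "\<dots> \<le> L * norm (x r' - x r)" by (rule f_lip)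
  finally have "ennreal (norm (forcing x r' - forcing x r)) \<le> ennreal L * ennreal (norm (x r' - x r))"
    using L by (simp add: ennreal_mult'[symmetric] ennreal_leI)
  also have "\<dots> \<le> ennreal L * (\<integral>\<^sup>+u\<in>{r<..r'}. W u \<partial>lborel)"
    using var r no by (intro mult_left_mono) (auto simp: varies_by_def)
  also have "\<dots> = (\<integral>\<^sup>+u\<in>{r<..r'}. (ennreal L * W u) \<partial>lborel)"
    by (simp add: nn_integral_cmult[symmetric] mult.assoc)
  finally show ?thesis by (simp add: add_increasing2)
qed

lemma rl_integral_forcing_variation:
  assumes x: "admissible x" and W [measurable]: "W \<in> borel_measurable borel"
    and var: "varies_by x W" and r: "r < r'"
  shows "ennreal (norm (rl_integral \<alpha> (forcing x) r' - rl_integral \<alpha> (forcing x) r))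
    \<le> (\<integral>\<^sup>+u\<in>{r<..r'}. majorant_step W u \<partial>lborel)"
  unfolding majorant_step_def
  by (rule rl_integral_variation[OF order _ r _ forcing_measurable[OF admissible_measurable[OF x]] forcing_integrable[OF x]
        forcing_variation[OF x W var]]) simp_all

lemma varies_by_picard:
  assumes x: "admissible x" and W [measurable]: "W \<in> borel_measurable borel" and var: "varies_by x W"
  shows "varies_by (picard x) (majorant_step W)"
  unfolding varies_by_def
proof (intro allI impI)
  fix r r' assume r: "r < r'" and no: "\<forall>j\<le>Suc m. t j \<notin> {r..<r'}"
  have "jumps x r' = jumps x r"
    unfolding jumps_def
  proof (intro sum.cong refl if_cong)
    fix k assume "k \<in> {1..m}"
    then have "t k \<notin> {r..<r'}" using no by simp
    then show "(t k < r') = (t k < r)" using r by auto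
  qed
  then show "ennreal (norm (picard x r' - picard x r)) \<le> (\<integral>\<^sup>+u\<in>{r<..r'}. majorant_step W u \<partial>lborel)"
    using rl_integral_forcing_variation[OF x W var r] by (simp add: picard_def)
qed

definition majorant :: "nat \<Rightarrow> real \<Rightarrow> ennreal" where
  "majorant n = (majorant_step ^^ n) (\<lambda>_. 0)"

lemma majorant_0: "majorant 0 = (\<lambda>_. 0)" and majorant_Suc: "majorant (Suc n) = majorant_step (majorant n)"
  by (simp_all add: majorant_def)

lemma majorant_measurable [measurable]: "majorant n \<in> borel_measurable borel"
  by (induction n) (simp_all add: majorant_0 majorant_Suc)

lemma incseq_majorant: "incseq majorant"
proof (rule incseq_SucI)
  fix n show "majorant n \<le> majorant (Suc n)"
  proof (induction n)
    case (Suc n)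
    then show ?case
      unfolding majorant_Suc le_fun_def majorant_step_def
      by (intro allI add_right_mono nn_integral_mono mult_left_mono) (auto simp: le_fun_def)
  qed (simp add: majorant_0 le_fun_def)
qed

lemma varies_by_iterate: "varies_by (iterate n) (majorant n)"
proof (induction n)
  case 0
  then show ?case by (simp add: varies_by_def iterate_0)
next
  case (Suc n)
  then show ?case
    unfolding iterate_Suc majorant_Suc by (intro varies_by_picard admissible_iterate) simp_all
qed

definition weighted :: "(real \<Rightarrow> ennreal) \<Rightarrow> ennreal" where
  "weighted W = (\<integral>\<^sup>+u. ennreal (exp (- \<theta> * u)) * W u \<partial>lborel)"

definition atoms_weight :: real where
  "atoms_weight = (\<Sum>j\<in>{..Suc m}. 2 * M * (\<omega> * exp (- \<theta> * t j)))"

lemma M_nonneg: "0 \<le> M"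
  using L R_nonneg by (simp add: M_def)

text \<open>On weighted masses the propagation of majorants is affine with slope \<open>L \<omega> < 1\<close>, so the masses
  of the iterated majorants stay below its fixed point.\<close>

lemma weighted_majorant_step:
  assumes [measurable]: "W \<in> borel_measurable borel"
  shows "weighted (majorant_step W) = ennreal (L * \<omega>) * weighted W + ennreal atoms_weight"
proof -
  have "weighted (majorant_step W)
    = (\<integral>\<^sup>+u. ennreal (exp (- \<theta> * u)) * (\<integral>\<^sup>+r. ennreal (rl_kernel \<alpha> (u - r)) * (ennreal L * W r) \<partial>lborel) \<partial>lborel)
      + (\<Sum>j\<in>{..Suc m}. ennreal (2 * M) * (\<integral>\<^sup>+u. ennreal (exp (- \<theta> * u) * rl_kernel \<alpha> (u - t j)) \<partial>lborel))"
  proof -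
    have "weighted (majorant_step W)
      = (\<integral>\<^sup>+u. ennreal (exp (- \<theta> * u)) * (\<integral>\<^sup>+r. ennreal (rl_kernel \<alpha> (u - r)) * (ennreal L * W r) \<partial>lborel)
        + (\<Sum>j\<in>{..Suc m}. ennreal (2 * M) * ennreal (exp (- \<theta> * u) * rl_kernel \<alpha> (u - t j))) \<partial>lborel)"
      unfolding weighted_def majorant_step_def
      by (intro nn_integral_cong)
        (simp add: distrib_left sum_distrib_left ennreal_mult' mult.left_commute del: sum.atMost_Suc)
    then show ?thesis by (simp add: nn_integral_add nn_integral_sum nn_integral_cmult del: sum.atMost_Suc)
  qed
  also have "(\<Sum>j\<in>{..Suc m}. ennreal (2 * M) * (\<integral>\<^sup>+u. ennreal (exp (- \<theta> * u) * rl_kernel \<alpha> (u - t j)) \<partial>lborel))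
      = ennreal atoms_weight"
    unfolding rl_kernel_laplace_future[OF order \<theta>_pos] \<theta>_\<omega> atoms_weight_def
    using M_nonneg \<omega>_pos by (subst sum_ennreal[symmetric]) (auto intro!: sum.cong simp: ennreal_mult' simp del: sum.atMost_Suc)
  also have "(\<integral>\<^sup>+u. ennreal (exp (- \<theta> * u)) * (\<integral>\<^sup>+r. ennreal (rl_kernel \<alpha> (u - r)) * (ennreal L * W r) \<partial>lborel) \<partial>lborel)
      = ennreal \<omega> * (\<integral>\<^sup>+r. ennreal (exp (- \<theta> * r)) * (ennreal L * W r) \<partial>lborel)"
    using rl_kernel_weighted[OF order \<theta>_pos, of "\<lambda>r. ennreal L * W r"] by (simp add: \<theta>_\<omega>)
  also have "(\<integral>\<^sup>+r. ennreal (exp (- \<theta> * r)) * (ennreal L * W r) \<partial>lborel) = ennreal L * weighted W"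
    unfolding weighted_def by (subst nn_integral_cmult[symmetric]) (auto simp: mult.left_commute)
  finally show ?thesis using L \<omega>_pos by (simp add: ennreal_mult' mult_ac)
qed

lemma weighted_majorant: "weighted (majorant n) \<le> ennreal (atoms_weight / (1 - L * \<omega>))"
proof (induction n)
  case 0
  then show ?case by (simp add: weighted_def majorant_0)
next
  case (Suc n)
  have aw: "0 \<le> atoms_weight"
    unfolding atoms_weight_def using M_nonneg \<omega>_pos by (intro sum_nonneg) auto
  have "weighted (majorant (Suc n)) \<le> ennreal (L * \<omega>) * ennreal (atoms_weight / (1 - L * \<omega>)) + ennreal atoms_weight"
    unfolding majorant_Suc by (subst weighted_majorant_step) (auto intro: add_right_mono mult_left_mono Suc)
  also have "\<dots> = ennreal (L * \<omega> * (atoms_weight / (1 - L * \<omega>)) + atoms_weight)"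
    using aw L\<omega> by (simp add: ennreal_mult'[symmetric])
  also have "L * \<omega> * (atoms_weight / (1 - L * \<omega>)) + atoms_weight = atoms_weight / (1 - L * \<omega>)"
    using L\<omega> by (simp add: field_simps)
  finally show ?case .
qed

definition majorant_sup :: "real \<Rightarrow> ennreal" where
  "majorant_sup u = (SUP n. majorant n u)"

lemma majorant_sup_measurable [measurable]: "majorant_sup \<in> borel_measurable borel"
  unfolding majorant_sup_def[abs_def] by measurable

lemma weighted_majorant_sup: "weighted majorant_sup < \<infinity>"
proof -
  have "weighted majorant_sup = (\<integral>\<^sup>+u. (SUP n. ennreal (exp (- \<theta> * u)) * majorant n u) \<partial>lborel)"
    unfolding weighted_def majorant_sup_def by (simp add: SUP_mult_left_ennreal)
  also have "\<dots> = (SUP n. weighted (majorant n))"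
    unfolding weighted_def
    using incseq_majorant
    by (intro nn_integral_monotone_convergence_SUP) (auto simp: incseq_def le_fun_def intro: mult_left_mono)
  also have "\<dots> \<le> ennreal (atoms_weight / (1 - L * \<omega>))"
    by (intro SUP_least weighted_majorant)
  finally show ?thesis by (rule le_less_trans) simp
qed

lemma varies_by_solution: "varies_by solution majorant_sup"
  unfolding varies_by_def
proof (intro allI impI)
  fix r r' assume r: "r < r'" and no: "\<forall>j\<le>Suc m. t j \<notin> {r..<r'}"
  have le: "ennreal (norm (iterate n r' - iterate n r)) \<le> (\<integral>\<^sup>+u\<in>{r<..r'}. majorant_sup u \<partial>lborel)" for n
  proof -
    have "ennreal (norm (iterate n r' - iterate n r)) \<le> (\<integral>\<^sup>+u\<in>{r<..r'}. majorant n u \<partial>lborel)"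
      using varies_by_iterate[of n] r no by (simp add: varies_by_def)
    also have "\<dots> \<le> (\<integral>\<^sup>+u\<in>{r<..r'}. majorant_sup u \<partial>lborel)"
      unfolding majorant_sup_def by (intro nn_integral_mono mult_right_mono SUP_upper) auto
    finally show ?thesis .
  qed
  have "(\<lambda>n. ennreal (norm (iterate n r' - iterate n r))) \<longlonglongrightarrow> ennreal (norm (solution r' - solution r))"
    by (intro tendsto_intros iterate_tendsto)
  then show "ennreal (norm (solution r' - solution r)) \<le> (\<integral>\<^sup>+u\<in>{r<..r'}. majorant_sup u \<partial>lborel)"
    by (rule LIMSEQ_le_const2) (use le in blast)
qed

text \<open>The majorant may take the value \<open>\<infinity>\<close> on a null set, and its integrability is claimed up to
  \<open>T\<close> only.\<close>

definition speed :: "real \<Rightarrow> real" where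
  "speed u = indicator {..T} u * enn2real (majorant_step majorant_sup u)"

lemma speed_nonneg: "0 \<le> speed u"
  by (simp add: speed_def)

lemma majorant_finite:
  "(\<integral>\<^sup>+u\<in>{..T}. majorant_step majorant_sup u \<partial>lborel) < \<infinity>"
proof -
  have "(\<integral>\<^sup>+u\<in>{..T}. majorant_step majorant_sup u \<partial>lborel)
      \<le> (\<integral>\<^sup>+u. ennreal (exp (\<theta> * T)) * (ennreal (exp (- \<theta> * u)) * majorant_step majorant_sup u) \<partial>lborel)"
  proof (rule nn_integral_mono)
    fix u
    show "majorant_step majorant_sup u * indicator {..T} u
        \<le> ennreal (exp (\<theta> * T)) * (ennreal (exp (- \<theta> * u)) * majorant_step majorant_sup u)"
    proof (cases "u \<le> T")
      case True
      then have "1 \<le> exp (\<theta> * T) * exp (- \<theta> * u)"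
        using \<theta>_pos by (simp add: exp_add[symmetric] mult_left_mono)
      then have "1 * majorant_step majorant_sup u \<le> ennreal (exp (\<theta> * T) * exp (- \<theta> * u)) * majorant_step majorant_sup u"
        by (intro mult_right_mono) (auto simp: ennreal_1[symmetric] simp del: ennreal_1 intro: ennreal_leI)
      then show ?thesis using True by (simp add: ennreal_mult' mult.assoc)
    qed simp
  qed
  also have "\<dots> = ennreal (exp (\<theta> * T)) * weighted (majorant_step majorant_sup)"
    unfolding weighted_def by (rule nn_integral_cmult) simp
  also have "\<dots> < \<infinity>"
    using weighted_majorant_sup by (simp add: weighted_majorant_step ennreal_mult_less_top)
  finally show ?thesis .
qed

lemma speed_ennreal:
  assumes "A \<in> sets borel" "A \<subseteq> {..T}"
  shows "(\<integral>\<^sup>+u\<in>A. ennreal (speed u) \<partial>lborel) = (\<integral>\<^sup>+u\<in>A. majorant_step majorant_sup u \<partial>lborel)"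
proof -
  have "AE u in lborel. majorant_step majorant_sup u * indicator {..T} u \<noteq> \<infinity>"
    using majorant_finite by (intro nn_integral_noteq_infinite) auto
  then show ?thesis
    using assms by (intro nn_integral_cong_AE) (auto elim!: eventually_mono simp: speed_def indicator_def less_top)
qed

lemma speed_integrable: "integrable lborel speed"
proof (rule integrableI_bounded)
  show "speed \<in> borel_measurable lborel" unfolding speed_def[abs_def] by measurable
  have "(\<integral>\<^sup>+u. ennreal (norm (speed u)) \<partial>lborel) = (\<integral>\<^sup>+u\<in>{..T}. ennreal (speed u) \<partial>lborel)"
    by (intro nn_integral_cong) (auto simp: speed_def indicator_def)
  then show "(\<integral>\<^sup>+u. ennreal (norm (speed u)) \<partial>lborel) < \<infinity>"
    using majorant_finite by (simp add: speed_ennreal)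
qed

lemma rl_integral_solution_variation:
  assumes ab: "a < b" "b \<le> T"
  shows "norm (rl_integral \<alpha> (forcing solution) b - rl_integral \<alpha> (forcing solution) a)
    \<le> (LINT u:{a<..b}|lborel. speed u)"
proof -
  have "ennreal (norm (rl_integral \<alpha> (forcing solution) b - rl_integral \<alpha> (forcing solution) a))
     \<le> (\<integral>\<^sup>+u\<in>{a<..b}. majorant_step majorant_sup u \<partial>lborel)"
    using admissible_solution _ varies_by_solution ab(1) by (rule rl_integral_forcing_variation) simp
  also have "\<dots> = (\<integral>\<^sup>+u\<in>{a<..b}. ennreal (speed u) \<partial>lborel)"
    using ab by (intro speed_ennreal[symmetric]) auto
  also have "\<dots> = (\<integral>\<^sup>+u. ennreal (indicator {a<..b} u * speed u) \<partial>lborel)"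
    by (intro nn_integral_cong) (auto simp: indicator_def)
  also have "\<dots> = ennreal (LINT u:{a<..b}|lborel. speed u)"
    using set_integrable_lborel_borel[OF speed_integrable, of "{a<..b}"] speed_nonneg
    unfolding set_lebesgue_integral_def real_scaleR_def
    by (intro nn_integral_eq_integral) (auto simp: set_integrable_def)
  finally show ?thesis
    using speed_nonneg by (subst (asm) ennreal_le_iff) (auto simp: set_lebesgue_integral_def)
qed

section \<open>The fixed point solves the impulsive Caputo system\<close>

lemma times_less_iff: "i \<le> Suc m \<Longrightarrow> j \<le> Suc m \<Longrightarrow> t i < t j \<longleftrightarrow> i < j"
  using times_mono[of i j] times_mono[of j i] by (metis less_asym linorder_less_linear)

lemma horizon_eq: "t (Suc m) = T" and start_eq: "t 0 = 0"
  using times by (simp_all add: impulse_times_def)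

text \<open>The part of the solution that carries its history; it is continuous across the impulses.\<close>

abbreviation memory :: "real \<Rightarrow> 'a" where
  "memory \<equiv> rl_integral \<alpha> (forcing solution)"

lemma solution_eq: "solution s = x0 + jumps solution s + memory s"
  by (metis solution_fixed_point picard_def)

lemma jumps_piece:
  assumes "k \<le> m" "s \<in> {t k<..t (Suc k)}"
  shows "jumps x s = jumps x (t (Suc k))"
  unfolding jumps_def
proof (intro sum.cong refl if_cong)
  fix j assume j: "j \<in> {1..m}"
  show "(t j < s) = (t j < t (Suc k))"
  proof
    assume "t j < t (Suc k)"
    then have "j \<le> k" using j assms by (simp add: times_less_iff)
    then have "t j \<le> t k" using j assms times_less_iff[of j k] by (cases "j = k") auto
    then show "t j < s" using assms by auto
  qed (use assms in auto)
qed

lemma jumps_start: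
  assumes "s \<le> t 1"
  shows "jumps x s = 0"
  unfolding jumps_def
proof (intro sum.neutral ballI)
  fix j assume j: "j \<in> {1..m}"
  then have "t 1 \<le> t j" using times_less_iff[of 1 j] by (cases "j = 1") auto
  then show "(if t j < s then U j (x (t j)) else 0) = 0" using assms by auto
qed

lemma jumps_step:
  assumes k: "k \<in> {1..m}"
  shows "jumps x (t (Suc k)) - jumps x (t k) = U k (x (t k))"
proof -
  \<comment> \<open>Up to \<open>t (Suc k)\<close> inclusive, exactly one more jump has occurred than up to \<open>t k\<close>.\<close>
  have "jumps x (t (Suc k)) - jumps x (t k) = (\<Sum>j\<in>{1..m}. if j = k then U j (x (t j)) else 0)"
    unfolding jumps_def sum_subtractf[symmetric]
    using k by (intro sum.cong) (auto simp: times_less_iff)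
  then show ?thesis using k by simp
qed

lemma solution_piece:
  assumes "k \<le> m" "s \<in> {t k<..t (Suc k)}"
  shows "solution s = x0 + jumps solution (t (Suc k)) + memory s"
  using jumps_piece[OF assms] by (simp add: solution_eq[of s])

lemma solution_start:
  assumes "s \<le> t 1"
  shows "solution s = x0 + memory s"
  using jumps_start[OF assms] by (simp add: solution_eq[of s])

lemma times_le_horizon: "k \<le> m \<Longrightarrow> t (Suc k) \<le> T"
  using times_less_iff[of "Suc k" "Suc m"] horizon_eq by (cases "k = m") auto

lemma memory_continuous_on: "continuous_on {..T} memory"
proof -
  have "continuous_on UNIV (\<lambda>s. memory (min s T))"
    using speed_integrable speed_nonneg variation_bound_clamp[OF speed_integrable speed_nonneg rl_integral_solution_variation]
    by (rule continuous_on_integral_bound)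
  then have "continuous_on {..T} (\<lambda>s. memory (min s T))" by (rule continuous_on_subset) simp
  then show ?thesis by (rule continuous_on_eq) (simp add: min_def)
qed

lemma memory_isCont: "s < T \<Longrightarrow> isCont memory s"
  using continuous_on_subset[OF memory_continuous_on, of "{..<T}"]
  by (simp add: continuous_on_eq_continuous_at subset_eq)

lemma solution_abs_continuous:
  "abs_continuous_on {0..t 1} solution"
  "k \<le> m \<Longrightarrow> abs_continuous_on {t k<..t (Suc k)} solution"
proof -
  show "abs_continuous_on {0..t 1} solution"
  proof (rule abs_continuous_on_integral_bound[OF speed_integrable speed_nonneg])
    fix a b assume ab: "a < b" "{a..b} \<subseteq> {0..t 1}"
    then have "a \<le> t 1" "b \<le> t 1" by auto
    moreover then have "b \<le> T" using times_le_horizon[of 0] by simp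
    ultimately show "norm (solution b - solution a) \<le> (LINT u:{a<..b}|lborel. speed u)"
      using rl_integral_solution_variation[OF ab(1)] by (simp add: solution_start)
  qed
  assume k: "k \<le> m"
  show "abs_continuous_on {t k<..t (Suc k)} solution"
  proof (rule abs_continuous_on_integral_bound[OF speed_integrable speed_nonneg])
    fix a b assume ab: "a < b" "{a..b} \<subseteq> {t k<..t (Suc k)}"
    then have "a \<in> {t k<..t (Suc k)}" "b \<in> {t k<..t (Suc k)}" by (meson atLeastAtMost_iff less_imp_le order_refl subsetD)+
    moreover then have "b \<le> T" using times_le_horizon[OF k] by simp
    ultimately show "norm (solution b - solution a) \<le> (LINT u:{a<..b}|lborel. speed u)"
      using rl_integral_solution_variation[OF ab(1)] by (simp add: solution_piece[OF k])
  qed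
qed

lemma solution_tendsto_left:
  assumes k: "k \<in> {1..m}"
  shows "(solution \<longlongrightarrow> solution (t k)) (at_left (t k))"
proof -
  obtain i where i: "k = Suc i" "i \<le> m" using k by (cases k) auto
  have lt: "t i < t k" "t k < T"
    using k i times_less_iff[of i k] times_less_iff[of k "Suc m"] horizon_eq by auto
  have "(memory \<longlongrightarrow> memory (t k)) (at_left (t k))"
    using memory_isCont[OF lt(2)] by (simp add: isCont_def filterlim_at_split)
  then have "((\<lambda>s. x0 + jumps solution (t k) + memory s) \<longlongrightarrow> solution (t k)) (at_left (t k))"
    unfolding solution_eq[of "t k"] by (intro tendsto_intros)
  moreover have "\<forall>\<^sub>F s in at_left (t k). x0 + jumps solution (t k) + memory s = solution s"
    using eventually_at_left_real[OF lt(1)] by eventually_elim (use solution_piece[OF i(2)] i(1) in auto)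
  ultimately show ?thesis by (rule Lim_transform_eventually)
qed

lemma solution_tendsto_right:
  assumes k: "k \<in> {1..m}"
  shows "(solution \<longlongrightarrow> solution (t k) + U k (solution (t k))) (at_right (t k))"
proof -
  have km: "k \<le> m" using k by simp
  have lt: "t k < t (Suc k)" "t k < T"
    using k times_less_iff[of k "Suc k"] times_less_iff[of k "Suc m"] horizon_eq by auto
  have "(memory \<longlongrightarrow> memory (t k)) (at_right (t k))"
    using memory_isCont[OF lt(2)] by (simp add: isCont_def filterlim_at_split)
  then have "((\<lambda>s. x0 + jumps solution (t (Suc k)) + memory s) \<longlongrightarrow> x0 + jumps solution (t (Suc k)) + memory (t k)) (at_right (t k))"
    by (intro tendsto_intros)
  moreover have "\<forall>\<^sub>F s in at_right (t k). x0 + jumps solution (t (Suc k)) + memory s = solution s"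
    using eventually_at_right_real[OF lt(1)] by eventually_elim (use solution_piece[OF km] in auto)
  ultimately have "(solution \<longlongrightarrow> x0 + jumps solution (t (Suc k)) + memory (t k)) (at_right (t k))"
    by (rule Lim_transform_eventually)
  also have "x0 + jumps solution (t (Suc k)) + memory (t k) = solution (t k) + U k (solution (t k))"
    using jumps_step[OF k, of solution] solution_eq[of "t k"] by (simp add: algebra_simps)
  finally show ?thesis .
qed

lemma solution_one_sided_limits: "one_sided_limits m t solution"
  unfolding one_sided_limits_def using solution_tendsto_left solution_tendsto_right by blast

lemma solution_PC: "solution \<in> PC m t"
  unfolding PC_def
proof (intro CollectI conjI ballI solution_one_sided_limits)
  have "t 1 \<le> T" using times_le_horizon[of 0] by simp
  then have "continuous_on {0..t 1} (\<lambda>s. x0 + memory s)"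
    by (intro continuous_intros continuous_on_subset[OF memory_continuous_on]) auto
  then show "continuous_on {0..t 1} solution"
    by (rule continuous_on_eq) (simp add: solution_start)
  fix k assume "k \<in> {1..m}"
  then have k: "k \<le> m" by simp
  have "continuous_on {t k<..t (Suc k)} (\<lambda>s. x0 + jumps solution (t (Suc k)) + memory s)"
    using times_le_horizon[OF k] by (intro continuous_intros continuous_on_subset[OF memory_continuous_on]) auto
  then show "continuous_on {t k<..t (Suc k)} solution"
    by (rule continuous_on_eq) (simp add: solution_piece[OF k])
qed

lemma solution_initial: "solution 0 = x0"
proof -
  have "memory 0 = 0" by (rule rl_integral_eq_0) (simp add: forcing_def)
  moreover have "0 \<le> t 1" using times_less_iff[of 0 1] start_eq by simp
  ultimately show ?thesis using solution_start[of 0] by simp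
qed

lemma forcing_lborel_integrable: "integrable lborel (forcing solution)"
proof (rule Bochner_Integration.integrable_bound[of _ "\<lambda>s. indicator {0<..T} s * M"])
  show "integrable lborel (\<lambda>s. indicator {0<..T} s * M)"
    using horizon by (intro integrable_mult_left integrable_real_indicator) (auto simp: emeasure_lborel_Ioc)
  show "forcing solution \<in> borel_measurable lborel"
    using forcing_measurable[OF admissible_measurable[OF admissible_solution]] by simp
  show "AE s in lborel. norm (forcing solution s) \<le> norm (indicator {0<..T} s * M)"
    
  proof (intro AE_I2)
    fix s
    show "norm (forcing solution s) \<le> norm (indicator {0<..T} s * M)"
      using forcing_bound[OF admissible_solution, of s] M_nonneg by (cases "s \<in> {0<..T}") (auto simp: forcing_def)
  qed
qed

lemma solution_has_vector_derivative:
  assumes s: "s < T" "s \<notin> t ` {1..m}"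
    and yz: "\<And>s. s \<le> T \<Longrightarrow> memory s = rl_integral 1 z s"
    and d: "(rl_integral 1 z has_vector_derivative z s) (at s)"
  shows "(solution has_vector_derivative z s) (at s)"
proof -
  have "open ({..<T} - t ` {1..m})" by (intro open_Diff finite_imp_closed) auto
  then obtain e where e: "0 < e" "ball s e \<subseteq> {..<T} - t ` {1..m}"
    using s by (meson DiffI lessThan_iff openE)
  have "((\<lambda>r. x0 + jumps solution s + rl_integral 1 z r) has_vector_derivative z s) (at s)"
    using has_vector_derivative_add[OF has_vector_derivative_const d] by simp
  then show ?thesis
  proof (rule has_vector_derivative_transform_within_open)
    fix r assume r: "r \<in> ball s e"
    have "jumps solution r = jumps solution s"
      unfolding jumps_def
    proof (intro sum.cong refl if_cong)
      fix j assume "j \<in> {1..m}"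
      then have "t j \<notin> ball s e" using e by auto
      then show "(t j < r) = (t j < s)" using r by (auto simp: dist_real_def)
    qed
    moreover have "r \<le> T" using r e by auto
    ultimately show "x0 + jumps solution s + rl_integral 1 z r = solution r"
      by (simp add: solution_eq[of r] yz)
  qed (use e in auto)
qed

text \<open>Off the impulse times the derivative of the solution is that of its memory term, namely the
  density \<open>z\<close>; multiplying \<open>J\<^sup>1\<^sup>-\<^sup>\<alpha> z = g\<close> by \<open>Gamma (1 - \<alpha>)\<close> gives the integral in the Caputo derivative.\<close>

lemma solution_caputo:
  assumes \<alpha>: "\<alpha> < 1"
  shows "AE s in lebesgue. s \<in> {0..T} - t ` {1..m} \<longrightarrow> has_caputo_derivative \<alpha> solution (f (solution s)) s"
proof -
  have f0: "forcing solution s = 0" if "s \<le> 0" for s using that by (simp add: forcing_def)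
  obtain z where z: "integrable lborel z" and z0: "\<And>s. s \<notin> {0<..T} \<Longrightarrow> z s = 0"
    and yz: "\<And>s. s \<le> T \<Longrightarrow> memory s = rl_integral 1 z s"
    using rl_integral_density[OF f0 speed_integrable speed_nonneg rl_integral_solution_variation]
    by blast
  have "AE r in lborel. (rl_integral 1 z has_vector_derivative z r) (at r)"
    using AE_has_vector_derivative_indefinite_integral[OF z] unfolding rl_integral_one[of z, abs_def] .
  then have D: "AE r in lborel. r < T \<longrightarrow> r \<notin> t ` {1..m} \<longrightarrow> (solution has_vector_derivative z r) (at r)"
    by eventually_elim (use solution_has_vector_derivative[OF _ _ yz] in blast)
  have "AE r in lborel. r \<notin> t ` {1..m}"
    by (intro AE_not_in countable_imp_null_set_lborel countable_finite) simp
  with D have D': "AE r in lebesgue. r < T \<longrightarrow> (solution has_vector_derivative z r) (at r)"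
    unfolding AE_completion_iff by eventually_elim blast
  have inv: "AE v in lborel. v < T \<longrightarrow> integrable lborel (\<lambda>r. rl_kernel (1 - \<alpha>) (v - r) *\<^sub>R z r)"
    "AE v in lborel. v < T \<longrightarrow> rl_integral (1 - \<alpha>) z v = forcing solution v"
    using rl_integral_inversion[OF order \<alpha> forcing_lborel_integrable z z0 yz] by blast+
  have G: "0 < Gamma (1 - \<alpha>)" using \<alpha> by (simp add: Gamma_real_pos)
  have "AE s in lborel. s \<in> {0..T} - t ` {1..m} \<longrightarrow> has_caputo_derivative \<alpha> solution (f (solution s)) s"
    using inv AE_lborel_singleton[of 0] AE_lborel_singleton[of T]
  proof eventually_elim
    case (elim s)
    show ?case
    proof
      assume "s \<in> {0..T} - t ` {1..m}"
      then have s: "0 < s" "s < T" using elim by auto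
      let ?k = "\<lambda>r. rl_kernel (1 - \<alpha>) (s - r) *\<^sub>R z r"
      let ?v = "\<lambda>r. (s - r) powr - \<alpha> *\<^sub>R vector_derivative solution (at r)"
      \<comment> \<open>The kernel and the support of \<open>z\<close> already restrict the integral to the interval from \<open>0\<close> to \<open>s\<close>.\<close>
      have k0: "indicator {0..s} r *\<^sub>R ?k r = ?k r" for r
        using z0[of r] by (cases "r \<in> {0<..T}") (auto simp: rl_kernel_def indicator_def)
      have kint: "integrable lebesgue ?k"
        using elim(1) s by (intro integrable_completion[THEN iffD2]) auto
      then have ki: "set_integrable lebesgue {0..s} (\<lambda>r. Gamma (1 - \<alpha>) *\<^sub>R ?k r)"
        unfolding set_integrable_def by (simp only: scaleR_left_commute[of _ "Gamma (1 - \<alpha>)"] k0 integrable_scaleR_right)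
      have ae: "AE r in lebesgue. r \<in> {0..s} \<longrightarrow> ?v r = Gamma (1 - \<alpha>) *\<^sub>R ?k r"
        using D'
      proof eventually_elim
        case (elim r)
        show ?case
        proof
          assume r: "r \<in> {0..s}"
          then have "vector_derivative solution (at r) = z r"
            using elim s by (intro vector_derivative_at) auto
          then show "?v r = Gamma (1 - \<alpha>) *\<^sub>R ?k r"
            using G r by (auto simp: rl_kernel_def indicator_def)
        qed
      qed
      then obtain N where N: "N \<in> null_sets lebesgue"
        "{r \<in> space lebesgue. \<not> (r \<in> {0..s} \<longrightarrow> ?v r = Gamma (1 - \<alpha>) *\<^sub>R ?k r)} \<subseteq> N"
        unfolding eventually_ae_filter by (elim bexE)
      then have "negligible N" by (simp add: negligible_iff_null_sets)
      have vi: "set_integrable lebesgue {0..s} ?v"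
        using ki \<open>negligible N\<close>
      proof (rule absolutely_integrable_spike)
        fix r assume r: "r \<in> {0..s} - N"
        show "?v r = Gamma (1 - \<alpha>) *\<^sub>R ?k r"
        proof (rule ccontr)
          assume "?v r \<noteq> Gamma (1 - \<alpha>) *\<^sub>R ?k r"
          then have "r \<in> {r \<in> space lebesgue. \<not> (r \<in> {0..s} \<longrightarrow> ?v r = Gamma (1 - \<alpha>) *\<^sub>R ?k r)}"
            using r by simp
          with N(2) have "r \<in> N" by (rule subsetD)
          then show False using r by blast
        qed
      qed
      have "(LINT r:{0..s}|lebesgue. ?v r) = (LINT r:{0..s}|lebesgue. Gamma (1 - \<alpha>) *\<^sub>R ?k r)"
        unfolding set_lebesgue_integral_def
        using vi ki ae unfolding set_integrable_def
        by (intro integral_cong_AE borel_measurable_integrable) (auto elim!: eventually_mono simp: indicator_def)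
      also have "\<dots> = Gamma (1 - \<alpha>) *\<^sub>R (\<integral>r. ?k r \<partial>lebesgue)"
        unfolding set_lebesgue_integral_def scaleR_left_commute[of _ "Gamma (1 - \<alpha>)"] k0
        by (rule integral_scaleR_right)
      also have "(\<integral>r. ?k r \<partial>lebesgue) = rl_integral (1 - \<alpha>) z s"
        unfolding rl_integral_def using elim(1) s by (intro integral_completion) (auto dest: borel_measurable_integrable)
      also have "\<dots> = f (solution s)"
        using elim(2) s by (simp add: forcing_def)
      finally have "(1 / Gamma (1 - \<alpha>)) *\<^sub>R (LINT r:{0..s}|lebesgue. ?v r) = f (solution s)"
        using G by simp
      moreover have "AE r in lebesgue. r \<in> {0..s} \<longrightarrow> solution differentiable at r"
        using D' by eventually_elim (use s in \<open>auto intro: differentiableI_vector\<close>)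
      ultimately show "has_caputo_derivative \<alpha> solution (f (solution s)) s"
        unfolding has_caputo_derivative_def using vi by simp
    qed
  qed
  then show ?thesis by (simp only: AE_completion_iff)
qed

end

section \<open>The projected field and the existence theorem\<close>

lemma matrix_vector_norm_bound:
  fixes A :: "real^'n^'n"
  obtains B where "0 \<le> B" "\<And>v. norm (A *v v) \<le> B * norm v"
proof -
  obtain B where "0 < B" "\<And>v. norm (A *v v) \<le> norm v * B"
    using bounded_linear.pos_bounded[OF matrix_vector_mul_bounded_linear] by blast
  then show thesis by (intro that[of B]) (auto simp: mult.commute)
qed

text \<open>The projection onto a closed convex set is nonexpansive.\<close>

lemma projection_field_lipschitz:
  fixes A :: "real^'n^'n"
  assumes K: "K \<noteq> {}" "closed K" "convex K"
  obtains L where "0 < L"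
    "\<And>u v. norm ((- u + closest_point K (u - \<rho> *\<^sub>R (A *v u) - \<rho> *\<^sub>R b))
          - (- v + closest_point K (v - \<rho> *\<^sub>R (A *v v) - \<rho> *\<^sub>R b))) \<le> L * norm (u - v)"
proof -
  obtain B where B: "0 \<le> B" "\<And>v. norm (A *v v) \<le> B * norm v"
    by (rule matrix_vector_norm_bound[of A]) blast
  show thesis
  proof (rule that[of "2 + \<bar>\<rho>\<bar> * B"])
    show "0 < 2 + \<bar>\<rho>\<bar> * B" using B by (intro add_pos_nonneg) auto
    fix u v :: "real^'n"
    let ?p = "\<lambda>u. u - \<rho> *\<^sub>R (A *v u) - \<rho> *\<^sub>R b"
    have "norm (closest_point K (?p u) - closest_point K (?p v)) \<le> norm (?p u - ?p v)"
      using closest_point_lipschitz[OF K(3,2,1), of "?p u" "?p v"] by (simp only: dist_norm)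
    also have "?p u - ?p v = (u - v) - \<rho> *\<^sub>R (A *v (u - v))"
      by (simp add: matrix_vector_mult_diff_distrib algebra_simps)
    also have "norm \<dots> \<le> norm (u - v) + \<bar>\<rho>\<bar> * (B * norm (u - v))"
      using B by (intro norm_triangle_le_diff add_left_mono) (simp add: mult_left_mono)
    finally have "norm (closest_point K (?p u) - closest_point K (?p v)) \<le> (1 + \<bar>\<rho>\<bar> * B) * norm (u - v)"
      by (simp add: algebra_simps)
    moreover have "(- u + closest_point K (?p u)) - (- v + closest_point K (?p v))
        = (closest_point K (?p u) - closest_point K (?p v)) - (u - v)"
      by simp
    then have "norm ((- u + closest_point K (?p u)) - (- v + closest_point K (?p v)))
        \<le> norm (closest_point K (?p u) - closest_point K (?p v)) + norm (u - v)"
      by (metis norm_triangle_ineq4)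
    ultimately show "norm ((- u + closest_point K (?p u)) - (- v + closest_point K (?p v))) \<le> (2 + \<bar>\<rho>\<bar> * B) * norm (u - v)"
      by (simp add: algebra_simps)
  qed
qed

theorem theorem3p2:
  fixes \<alpha> T \<rho> l1 l2 :: real
    and m :: nat
    and t :: "nat \<Rightarrow> real"
    and A :: "real^'n^'n"
    and b x0 :: "real^'n"
    and K :: "(real^'n) set"
    and U :: "nat \<Rightarrow> real^'n \<Rightarrow> real^'n"
  assumes "0 < \<alpha>" and "\<alpha> < 1"
    and "0 < T"
    and "impulse_times m T t"
    and "K \<noteq> {}" and "closed K" and "convex K"
    and "0 < l1" and "0 < l2"
    and "\<And>k x. k \<in> {1..m} \<Longrightarrow> norm (U k x) \<le> l1"
    and "\<And>k x y. k \<in> {1..m} \<Longrightarrow> norm (U k x - U k y) \<le> l2 * norm (x - y)"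
    and "(1 + spectral_norm (mat 1 - \<rho> *\<^sub>R A)) / Gamma (\<alpha> + 1) * T powr \<alpha> < 1"
    and "real m * l2 + T powr \<alpha> / Gamma (\<alpha> + 1) < 1"
  shows "\<exists>x. x \<in> PC m t \<and> is_solution \<alpha> T m t A b \<rho> K U x0 x"
proof -
  define f where "f v = - v + closest_point K (v - \<rho> *\<^sub>R (A *v v) - \<rho> *\<^sub>R b)" for v
  obtain L where L: "0 < L" "\<And>u v. norm (f u - f v) \<le> L * norm (u - v)"
    unfolding f_def using projection_field_lipschitz[OF assms(5-7), of \<rho> A b] by blast
  have "0 < T powr \<alpha> / Gamma (\<alpha> + 1)"
    using assms(1,3) by (simp add: Gamma_real_pos)
  then have "real m * l2 < 1" using assms(13) by linarith
  then interpret impulsive_volterra \<alpha> T L l1 l2 m t f U x0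
    using assms L by unfold_locales auto
  have "is_solution \<alpha> T m t A b \<rho> K U x0 solution"
    unfolding is_solution_def
  proof (intro conjI ballI solution_abs_continuous(1) solution_one_sided_limits solution_initial)
    show "abs_continuous_on {t k<..t (Suc k)} solution" if "k \<in> {1..m}" for k
      using that by (intro solution_abs_continuous(2)) simp
    show "AE s in lebesgue. s \<in> {0..T} - t ` {1..m} \<longrightarrow>
        has_caputo_derivative \<alpha> solution
          (- solution s + closest_point K (solution s - \<rho> *\<^sub>R (A *v solution s) - \<rho> *\<^sub>R b)) s"
      using solution_caputo[OF assms(2)] unfolding f_def .
    show "Lim (at_right (t k)) solution - Lim (at_left (t k)) solution = U k (solution (t k))"
      if k: "k \<in> {1..m}" for k
      using tendsto_Lim[OF _ solution_tendsto_right[OF k]] tendsto_Lim[OF _ solution_tendsto_left[OF k]]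
      by simp
  qed
  then show ?thesis using solution_PC by blast
qed

end
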